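(* Let $n\ge 2$ be an integer and let $\rho$ be a density function on $\mathbb{R}^n$ with $\rho\not\equiv 0$ (i.e. $\rho$ is nonzero on a set of positive Lebesgue measure). Let $$E_\rho(x)=\exp\left[-\frac{2}{\omega_n}\int_{\mathbb{R}^n}\frac{\rho(\zeta)\,d\zeta}{|x-\zeta|^{n}}\right]$$ be its exponential transform. Then the function $$x\mapsto \begin{cases}\ln\bigl(1-E_\rho(x)\bigr), & n=2,\\[4pt] \dfrac{1}{n-2}\bigl(1-E_\rho(x)\bigr)^{(n-2)/n}, & n\ge 3,\end{cases}$$ is subharmonic in $\mathbb{R}^n\setminus \operatorname{supp}\rho$.
   Context: A density function on $\mathbb{R}^n$ is a measurable function $\rho$ with compact support and $0\le\rho\le 1$; $\operatorname{supp}\rho$ is its closed (essential) support. $\omega_n$ denotes the $(n-1)$-dimensional Lebesgue measure of the unit sphere in $\mathbb{R}^n$. For $x\notin\operatorname{supp}\rho$ and $\rho\not\equiv0$ one has $0<E_\rho(x)<1$. *)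

theory Defs
  imports "HOL-Analysis.Analysis"
begin

text \<open>Closed essential support: the complement of the largest open set on which
  \<open>f\<close> vanishes almost everywhere.\<close>

definition ess_support :: "('a::euclidean_space \<Rightarrow> real) \<Rightarrow> 'a set" where
  "ess_support f =
     {x. \<forall>U. open U \<and> x \<in> U \<longrightarrow> \<not> (AE y in lebesgue. y \<in> U \<longrightarrow> f y = 0)}"

definition density_function :: "('a::euclidean_space \<Rightarrow> real) \<Rightarrow> bool" where
  "density_function \<rho> \<longleftrightarrow>
     \<rho> \<in> borel_measurable lebesgue \<and> compact (ess_support \<rho>) \<and> (\<forall>x. 0 \<le> \<rho> x \<and> \<rho> x \<le> 1)"

text \<open>Surface measure on the unit sphere, defined through polar coordinates: the measure
  of \<open>A\<close> is \<open>n\<close> times the Lebesgue measure of the cone over \<open>A\<close> of height 1.\<close>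

definition sphere_measure :: "'a::euclidean_space set \<Rightarrow> real" where
  "sphere_measure A =
     real DIM('a) * measure lebesgue {r *\<^sub>R a | r a. 0 < r \<and> r \<le> 1 \<and> a \<in> A}"

text \<open>The integrand is Lebesgue integrable for \<open>x\<close> outside the support of a density
  function; the value at other points is immaterial here.\<close>

definition exp_transform :: "('a::euclidean_space \<Rightarrow> real) \<Rightarrow> 'a \<Rightarrow> real" where
  "exp_transform \<rho> x =
     exp (- (2 / sphere_measure (sphere (0::'a) 1)) *
            (LINT \<zeta>|lebesgue. \<rho> \<zeta> / norm (x - \<zeta>) ^ DIM('a)))"

definition partial_deriv :: "'a::euclidean_space \<Rightarrow> ('a \<Rightarrow> real) \<Rightarrow> 'a \<Rightarrow> real" where
  "partial_deriv i f x = frechet_derivative f (at x) i"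

definition laplacian :: "('a::euclidean_space \<Rightarrow> real) \<Rightarrow> 'a \<Rightarrow> real" where
  "laplacian f x = (\<Sum>i\<in>Basis. partial_deriv i (partial_deriv i f) x)"

definition C2_on :: "('a::euclidean_space \<Rightarrow> real) \<Rightarrow> 'a set \<Rightarrow> bool" where
  "C2_on f U \<longleftrightarrow>
     (\<forall>x\<in>U. f differentiable (at x)) \<and>
     (\<forall>i\<in>Basis. \<forall>x\<in>U. partial_deriv i f differentiable (at x)) \<and>
     (\<forall>i\<in>Basis. \<forall>j\<in>Basis. continuous_on U (partial_deriv j (partial_deriv i f)))"

definition harmonic_on :: "('a::euclidean_space \<Rightarrow> real) \<Rightarrow> 'a set \<Rightarrow> bool" where
  "harmonic_on h U \<longleftrightarrow> open U \<and> C2_on h U \<and> (\<forall>x\<in>U. laplacian h x = 0)"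

text \<open>Subharmonicity in the sense of F. Riesz, for real-valued functions: upper
  semicontinuous, and dominated on every closed ball in the open set \<open>U\<close> by any
  continuous function, harmonic inside the ball, that dominates it on the bounding sphere.\<close>

definition subharmonic_on :: "('a::euclidean_space \<Rightarrow> real) \<Rightarrow> 'a set \<Rightarrow> bool" where
  "subharmonic_on u U \<longleftrightarrow>
     open U \<and>
     (\<forall>c. open {x \<in> U. u x < c}) \<and>
     (\<forall>a r h. 0 < r \<longrightarrow> cball a r \<subseteq> U \<longrightarrow>
        continuous_on (cball a r) h \<longrightarrow> harmonic_on h (ball a r) \<longrightarrow>
        (\<forall>x \<in> sphere a r. u x \<le> h x) \<longrightarrow>
        (\<forall>x \<in> cball a r. u x \<le> h x))"

end

theory Submission
  imports Defs
begin

text \<open>Write \<open>u(x) = \<integral> \<rho>(\<zeta>) |x - \<zeta>|\<^sup>-\<^sup>n d\<zeta>\<close>, \<open>A = \<integral> \<rho>(\<zeta>) |x - \<zeta>|\<^sup>-\<^sup>n\<^sup>-\<^sup>2 d\<zeta>\<close> and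
  \<open>B = \<integral> \<rho>(\<zeta>) (x - \<zeta>) |x - \<zeta>|\<^sup>-\<^sup>n\<^sup>-\<^sup>2 d\<zeta>\<close>, so that \<open>\<Delta>u = 2nA\<close> and \<open>\<nabla>u = - nB\<close>. With \<open>\<kappa>\<close> the
  volume of the unit ball and \<open>E = exp (- 2u/(n\<kappa>))\<close>, the Laplacian of the function in question is
  nonnegative iff \<open>|B|\<^sup>2 \<le> \<kappa> A (1 - E) / (1 - (1 - 2/n) E)\<close>.

  For a unit vector \<open>e\<close> and \<open>\<sigma> > 0\<close>, \<open>0 < a < 1\<close>, the functional \<open>2\<sigma> (B \<bullet> e) - \<sigma>\<^sup>2 A - (1 - a) u\<close> is linear
  in \<open>\<rho>\<close>, hence maximal among \<open>0 \<le> \<rho> \<le> 1\<close> for the indicator of a ball, and the maximum is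
  \<open>H(a) = \<integral> (a - |w|\<^sup>2)\<^sub>+ |e + w|\<^sup>-\<^sup>n dw\<close>. Since \<open>(1 - |w|\<^sup>2) |e + w|\<^sup>-\<^sup>n\<close> is the Poisson kernel, the mean value
  property gives \<open>(1 - a) H' + H = \<kappa> a\<^sup>n\<^sup>/\<^sup>2\<close>; integrating this and using \<open>1 - a \<le> (1 - m)(1 - (1 - 2/n) m)\<close>
  for \<open>m = a\<^sup>n\<^sup>/\<^sup>2\<close> bounds \<open>H\<close> by \<open>\<kappa> m - (1 - a) u\<close> when \<open>m = (1 - E) / (1 - (1 - 2/n) E)\<close>. Optimizing
  over \<open>\<sigma>\<close> yields the inequality.\<close>

subsection \<open>Differentiation under the integral sign\<close>

text \<open>Dominated convergence for the difference quotients at the single point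
  \<open>x0\<close>: the increment and the linear term are each bounded by \<open>C z\<close> times
  the step. Differentiability is asked only at \<open>x0\<close> and for almost every
  \<open>z\<close>, because the truncated powers integrated later have a kink on a null set that
  moves with the parameter.\<close>

lemma has_derivative_integral_dominated:
  fixes f :: "'a::euclidean_space \<Rightarrow> 'b \<Rightarrow> real" and g :: "'b \<Rightarrow> 'a"
  assumes "r > 0"
    and int: "\<And>x. x \<in> ball x0 r \<Longrightarrow> integrable M (f x)"
    and C: "integrable M C"
    and g[measurable]: "g \<in> borel_measurable M"
    and bound: "AE z in M. norm (g z) \<le> C z"
    and deriv: "AE z in M. ((\<lambda>x. f x z) has_derivative (\<lambda>h. h \<bullet> g z)) (at x0)"
    and lip: "AE z in M. \<forall>x\<in>ball x0 r. \<bar>f x z - f x0 z\<bar> \<le> C z * norm (x - x0)"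
  shows "integrable M g"
    and "((\<lambda>x. \<integral>z. f x z \<partial>M) has_derivative (\<lambda>h. h \<bullet> (\<integral>z. g z \<partial>M))) (at x0)"
proof -
  show gint: "integrable M g"
    using bound by (intro Bochner_Integration.integrable_bound[OF C g]) auto
  let ?B = "ball x0 r"
  have "(\<lambda>k. norm ((\<integral>z. f (X k) z \<partial>M) - (\<integral>z. f x0 z \<partial>M) - (X k - x0) \<bullet> (\<integral>z. g z \<partial>M)) / norm (X k - x0))
          \<longlonglongrightarrow> 0"
    if X: "\<And>k. X k \<in> ?B - {x0}" and lim: "X \<longlonglongrightarrow> x0" for X :: "nat \<Rightarrow> 'a"
  proof -
    define s where "s k z = (f (X k) z - f x0 z - (X k - x0) \<bullet> g z) / norm (X k - x0)" for k z
    have fX: "integrable M (f (X k))" "integrable M (f x0)" for k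
      using X[of k] \<open>r > 0\<close> int by auto
    note [measurable] = borel_measurable_integrable[OF fX(1)] borel_measurable_integrable[OF fX(2)]
    have s_int: "(\<integral>z. s k z \<partial>M) =
        ((\<integral>z. f (X k) z \<partial>M) - (\<integral>z. f x0 z \<partial>M) - (X k - x0) \<bullet> (\<integral>z. g z \<partial>M)) / norm (X k - x0)" for k
      unfolding s_def using fX gint by (simp add: Bochner_Integration.integral_diff)
    have "(\<lambda>k. \<integral>z. s k z \<partial>M) \<longlonglongrightarrow> (\<integral>z. 0 \<partial>M)"
    proof (rule integral_dominated_convergence[where w="\<lambda>z. 2 * C z"])
      show "AE z in M. (\<lambda>k. s k z) \<longlonglongrightarrow> 0"
        using deriv
      proof eventually_elim
        case (elim z)
        then have "((\<lambda>y. norm (f y z - f x0 z - (y - x0) \<bullet> g z) / norm (y - x0)) \<longlongrightarrow> 0) (at x0)"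
          by (simp add: has_derivative_iff_norm)
        then have "((\<lambda>y. norm (f y z - f x0 z - (y - x0) \<bullet> g z) / norm (y - x0)) \<circ> X) \<longlonglongrightarrow> 0"
          using X lim unfolding tendsto_at_iff_sequentially by auto
        then have "(\<lambda>k. norm (s k z)) \<longlonglongrightarrow> 0"
          by (simp add: s_def o_def norm_divide)
        then show ?case by (rule tendsto_norm_zero_cancel)
      qed
      show "AE z in M. norm (s k z) \<le> 2 * C z" for k
        using lip bound
      proof eventually_elim
        case (elim z)
        have "\<bar>f (X k) z - f x0 z - (X k - x0) \<bullet> g z\<bar> \<le> \<bar>f (X k) z - f x0 z\<bar> + \<bar>(X k - x0) \<bullet> g z\<bar>"
          by (rule abs_triangle_ineq4)
        also have "\<dots> \<le> C z * norm (X k - x0) + norm (X k - x0) * C z"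
          using elim X[of k] Cauchy_Schwarz_ineq2[of "X k - x0" "g z"]
          by (intro add_mono) (auto intro: order_trans[OF _ mult_left_mono])
        finally show ?case
          using X[of k] by (simp add: s_def field_simps)
      qed
    qed (use C in \<open>auto simp: s_def\<close>)
    then have "(\<lambda>k. norm (\<integral>z. s k z \<partial>M)) \<longlonglongrightarrow> 0"
      by (simp add: tendsto_norm_zero del: real_norm_def)
    then show ?thesis by (simp add: s_int norm_divide)
  qed
  then have "((\<lambda>x. \<integral>z. f x z \<partial>M) has_derivative (\<lambda>h. h \<bullet> (\<integral>z. g z \<partial>M))) (at x0 within ?B)"
    unfolding has_derivative_iff_norm tendsto_at_iff_sequentially o_def
    by (auto intro: bounded_linear_inner_left)
  then show "((\<lambda>x. \<integral>z. f x z \<partial>M) has_derivative (\<lambda>h. h \<bullet> (\<integral>z. g z \<partial>M))) (at x0)"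
    using \<open>r > 0\<close> by (simp add: at_within_open[OF _ open_ball])
qed

text \<open>For \<open>y\<close> near \<open>x\<close> and \<open>\<zeta>\<close> in
  \<open>S\<close> the differences \<open>y - \<zeta>\<close> fill a compact set \<open>T\<close>
  that misses the singularity at 0. There \<open>k\<close> and \<open>g\<close> are bounded, and the
  mean value inequality on the convex ball around \<open>x\<close> supplies the Lipschitz bound
  needed for differentiation under the integral.\<close>

lemma has_derivative_convolution:
  fixes \<rho> :: "'a::euclidean_space \<Rightarrow> real" and k :: "'a \<Rightarrow> real" and g :: "'a \<Rightarrow> 'a"
  assumes \<rho>[measurable]: "\<rho> \<in> borel_measurable lebesgue" and \<rho>1: "\<And>\<zeta>. \<bar>\<rho> \<zeta>\<bar> \<le> 1"
    and S: "compact S" and \<rho>0: "\<And>\<zeta>. \<zeta> \<notin> S \<Longrightarrow> \<rho> \<zeta> = 0" and x: "x \<notin> S"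
    and k[measurable]: "k \<in> borel_measurable borel" and g[measurable]: "g \<in> borel_measurable borel"
    and deriv: "\<And>z. z \<noteq> 0 \<Longrightarrow> (k has_derivative (\<lambda>h. h \<bullet> g z)) (at z)"
    and gc: "continuous_on (- {0}) g"
  shows "integrable lebesgue (\<lambda>\<zeta>. \<rho> \<zeta> * k (x - \<zeta>))"
    and "integrable lebesgue (\<lambda>\<zeta>. \<rho> \<zeta> *\<^sub>R g (x - \<zeta>))"
    and "((\<lambda>x. \<integral>\<zeta>. \<rho> \<zeta> * k (x - \<zeta>) \<partial>lebesgue) has_derivative
           (\<lambda>h. h \<bullet> (\<integral>\<zeta>. \<rho> \<zeta> *\<^sub>R g (x - \<zeta>) \<partial>lebesgue))) (at x)"
proof -
  have kc: "continuous_on (- {0}) k"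
    by (intro continuous_at_imp_continuous_on ballI has_derivative_continuous[OF deriv]) auto
  have "open (- S)" using S by (simp add: compact_imp_closed open_Compl)
  then obtain r where r: "r > 0" "cball x r \<subseteq> - S"
    using x open_contains_cball by blast
  define T where "T = (\<lambda>(y, \<zeta>). y - \<zeta>) ` (cball x r \<times> S)"
  have T: "compact T" "T \<subseteq> - {0}"
    using r(2) unfolding T_def
    by (auto intro!: compact_continuous_image compact_Times S continuous_intros simp: case_prod_beta subset_eq)
  have inT: "y - \<zeta> \<in> T" if "y \<in> cball x r" "\<zeta> \<in> S" for y \<zeta>
    using that by (auto simp: T_def image_iff intro!: bexI[of _ "(y, \<zeta>)"])
  obtain C1 where C1: "\<And>z. z \<in> T \<Longrightarrow> norm (k z) \<le> C1"
    using compact_imp_bounded[OF compact_continuous_image[OF continuous_on_subset[OF kc T(2)] T(1)]]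
    unfolding bounded_iff by blast
  obtain C2 where C2: "\<And>z. z \<in> T \<Longrightarrow> norm (g z) \<le> C2"
    using compact_imp_bounded[OF compact_continuous_image[OF continuous_on_subset[OF gc T(2)] T(1)]]
    unfolding bounded_iff by blast
  have indS: "integrable lebesgue (\<lambda>\<zeta>. indicator S \<zeta> * c)" for c :: real
    using borel_integrable_compact[OF S continuous_on_const[of S c]] S
    by (subst integrable_completion) (auto intro!: borel_measurable_times borel_measurable_indicator simp: compact_imp_closed)
  have [measurable]: "(\<lambda>\<zeta>::'a. \<zeta>) \<in> borel_measurable lebesgue"
    using measurable_completion[of "\<lambda>\<zeta>. \<zeta>" lborel borel] by simp
  have int: "integrable lebesgue (\<lambda>\<zeta>. \<rho> \<zeta> * k (y - \<zeta>))" if "y \<in> cball x r" for y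
  proof (rule Bochner_Integration.integrable_bound[OF indS[of C1]])
    show "AE \<zeta> in lebesgue. norm (\<rho> \<zeta> * k (y - \<zeta>)) \<le> norm (indicator S \<zeta> * C1)"
    proof (intro AE_I2)
      fix \<zeta>
      show "norm (\<rho> \<zeta> * k (y - \<zeta>)) \<le> norm (indicator S \<zeta> * C1)"
      proof (cases "\<zeta> \<in> S")
        case True
        have "\<bar>\<rho> \<zeta>\<bar> * \<bar>k (y - \<zeta>)\<bar> \<le> 1 * \<bar>C1\<bar>"
          using \<rho>1 C1[OF inT[OF that True]] by (intro mult_mono) auto
        then show ?thesis using True by (simp add: abs_mult)
      qed (simp add: \<rho>0)
    qed
  qed measurable
  show "integrable lebesgue (\<lambda>\<zeta>. \<rho> \<zeta> * k (x - \<zeta>))"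
    using int r by simp
  have gbound: "norm (\<rho> \<zeta> *\<^sub>R g (x - \<zeta>)) \<le> indicator S \<zeta> * C2" for \<zeta>
  proof (cases "\<zeta> \<in> S")
    case True
    have "\<bar>\<rho> \<zeta>\<bar> * norm (g (x - \<zeta>)) \<le> 1 * C2"
      using \<rho>1 C2[OF inT[OF _ True], of x] r by (intro mult_mono) auto
    then show ?thesis using True by simp
  qed (simp add: \<rho>0)
  have lip: "\<bar>\<rho> \<zeta> * k (y - \<zeta>) - \<rho> \<zeta> * k (x - \<zeta>)\<bar> \<le> indicator S \<zeta> * C2 * norm (y - x)"
    if y: "y \<in> ball x r" for y \<zeta>
  proof (cases "\<zeta> \<in> S")
    case True
    have "norm (k (y - \<zeta>) - k (x - \<zeta>)) \<le> C2 * norm (y - x)"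
    proof (rule differentiable_bound[of "cball x r" "\<lambda>y. k (y - \<zeta>)" "\<lambda>y h. h \<bullet> g (y - \<zeta>)"])
      fix y assume y: "y \<in> cball x r"
      have nz: "y - \<zeta> \<noteq> 0" using inT[OF y True] T(2) by auto
      show "((\<lambda>y. k (y - \<zeta>)) has_derivative (\<lambda>h. h \<bullet> g (y - \<zeta>))) (at y within cball x r)"
        by (rule has_derivative_compose[of "\<lambda>y. y - \<zeta>" "\<lambda>h. h", OF _ deriv[OF nz]])
          (auto intro!: derivative_eq_intros)
      show "onorm (\<lambda>h. h \<bullet> g (y - \<zeta>)) \<le> C2"
      proof (rule onorm_le)
        fix h
        have "norm (h \<bullet> g (y - \<zeta>)) \<le> norm h * norm (g (y - \<zeta>))"
          by (simp add: Cauchy_Schwarz_ineq2)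
        also have "\<dots> \<le> norm h * C2" by (intro mult_left_mono C2 inT y True) auto
        finally show "norm (h \<bullet> g (y - \<zeta>)) \<le> C2 * norm h" by (simp add: mult.commute)
      qed
    qed (use y r in auto)
    then have "\<bar>\<rho> \<zeta>\<bar> * \<bar>k (y - \<zeta>) - k (x - \<zeta>)\<bar> \<le> 1 * (C2 * norm (y - x))"
      using \<rho>1 by (intro mult_mono) auto
    then show ?thesis using True by (simp add: abs_mult right_diff_distrib[symmetric])
  qed (simp add: \<rho>0)
  have der: "((\<lambda>y. \<rho> \<zeta> * k (y - \<zeta>)) has_derivative (\<lambda>h. h \<bullet> (\<rho> \<zeta> *\<^sub>R g (x - \<zeta>)))) (at x)" for \<zeta>
  proof (cases "\<zeta> \<in> S")
    case True
    then have nz: "x - \<zeta> \<noteq> 0" using x by auto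
    have "((\<lambda>y. k (y - \<zeta>)) has_derivative (\<lambda>h. h \<bullet> g (x - \<zeta>))) (at x)"
      by (rule has_derivative_compose[of "\<lambda>y. y - \<zeta>" "\<lambda>h. h", OF _ deriv[OF nz]])
        (auto intro!: derivative_eq_intros)
    from has_derivative_mult_right[OF this, of "\<rho> \<zeta>"] show ?thesis by simp
  qed (simp add: \<rho>0)
  have meas: "(\<lambda>\<zeta>. \<rho> \<zeta> *\<^sub>R g (x - \<zeta>)) \<in> borel_measurable lebesgue"
    by measurable
  note res = has_derivative_integral_dominated[OF r(1), of x lebesgue "\<lambda>y \<zeta>. \<rho> \<zeta> * k (y - \<zeta>)",
      OF _ indS[of C2] meas AE_I2[OF gbound] AE_I2[OF der] AE_I2, OF int, OF _ ballI[OF lip]]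
  show "integrable lebesgue (\<lambda>\<zeta>. \<rho> \<zeta> *\<^sub>R g (x - \<zeta>))"
    by (rule res(1)) (auto simp: less_imp_le)
  show "((\<lambda>x. \<integral>\<zeta>. \<rho> \<zeta> * k (x - \<zeta>) \<partial>lebesgue) has_derivative
           (\<lambda>h. h \<bullet> (\<integral>\<zeta>. \<rho> \<zeta> *\<^sub>R g (x - \<zeta>) \<partial>lebesgue))) (at x)"
    by (rule res(2)) (auto simp: less_imp_le)
qed

subsection \<open>Subharmonicity from the Laplacian\<close>

text \<open>If \<open>c\<close> were positive, \<open>f'\<close>, which vanishes at 0, would be
  positive just to the right of 0, and the mean value theorem would make \<open>f\<close> exceed
  \<open>f 0\<close> there.\<close>

lemma second_derivative_nonpos_at_local_max:
  fixes f :: "real \<Rightarrow> real"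
  assumes "d > 0" and max: "\<And>t. \<bar>t\<bar> < d \<Longrightarrow> f t \<le> f 0"
    and f': "\<And>t. \<bar>t\<bar> < d \<Longrightarrow> (f has_real_derivative f' t) (at t)"
    and f'': "(f' has_real_derivative c) (at 0)"
  shows "c \<le> 0"
proof (rule ccontr)
  assume "\<not> c \<le> 0"
  have "f' 0 = 0"
    using DERIV_local_max[OF f' \<open>d > 0\<close>] max \<open>d > 0\<close> by auto
  then obtain e where e: "e > 0" "\<And>h. 0 < h \<Longrightarrow> h < e \<Longrightarrow> 0 < f' h"
    using DERIV_pos_inc_right[OF f''] \<open>\<not> c \<le> 0\<close> by auto
  define s where "s = min d e / 2"
  have s: "0 < s" "s < d" "s < e" using \<open>d > 0\<close> e(1) by (auto simp: s_def)
  obtain z where z: "0 < z" "z < s" "f s - f 0 = (s - 0) * f' z"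
    using MVT2[of 0 s f f'] s f' by auto
  then have "f s - f 0 > 0" using e(2)[of z] s by simp
  then show False using max[of s] s by auto
qed

lemma has_derivative_line:
  fixes f :: "'a::real_normed_vector \<Rightarrow> real"
  assumes "(f has_derivative D) (at (x + t *\<^sub>R i))"
  shows "((\<lambda>t. f (x + t *\<^sub>R i)) has_real_derivative D i) (at t)"
proof -
  have "((\<lambda>t. x + t *\<^sub>R i) has_derivative (\<lambda>h. h *\<^sub>R i)) (at t)"
    by (auto intro!: derivative_eq_intros)
  from diff_chain_at[OF this, of f D] assms
  have "((\<lambda>t. f (x + t *\<^sub>R i)) has_derivative (\<lambda>h. D (h *\<^sub>R i))) (at t)"
    by (simp add: o_def)
  moreover have "D (h *\<^sub>R i) = D i * h" for h
    using has_derivative_bounded_linear[OF assms]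
    by (simp add: linear_simps bounded_linear.linear linear_scale)
  ultimately show ?thesis
    by (simp add: has_field_derivative_def)
qed

text \<open>Maximum principle by perturbation. Adding \<open>\<epsilon> |x - a|^2\<close> to
  \<open>w - h\<close> makes the sum of second derivatives strictly positive, so the maximum over
  the closed ball is not interior; if \<open>w\<close> exceeded \<open>h\<close> somewhere, a small
  \<open>\<epsilon>\<close> would also keep it off the sphere.\<close>

lemma laplacian_nonneg_imp_subharmonic_on:
  fixes w :: "'a::euclidean_space \<Rightarrow> real"
  assumes U: "open U" and cont: "continuous_on U w"
    and g: "\<And>x i. x \<in> U \<Longrightarrow> i \<in> Basis \<Longrightarrow>
          ((\<lambda>t. w (x + t *\<^sub>R i)) has_real_derivative g i x) (at 0)"
    and k: "\<And>x i. x \<in> U \<Longrightarrow> i \<in> Basis \<Longrightarrow>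
          ((\<lambda>t. g i (x + t *\<^sub>R i)) has_real_derivative k i x) (at 0)"
    and nonneg: "\<And>x. x \<in> U \<Longrightarrow> 0 \<le> (\<Sum>i\<in>Basis. k i x)"
  shows "subharmonic_on w U"
  unfolding subharmonic_on_def
proof (intro conjI allI impI ballI)
  fix c show "open {x \<in> U. w x < c}"
  proof -
    have "{x \<in> U. w x < c} = U \<inter> w -` {..<c}" by auto
    then show ?thesis using continuous_open_preimage[OF cont U, of "{..<c}"] by simp
  qed
next
  fix a r h x1
  assume r: "0 < r" and sub: "cball a r \<subseteq> U" and hc: "continuous_on (cball a r) h"
    and harm: "harmonic_on h (ball a r)" and bd: "\<forall>x\<in>sphere a r. w x \<le> h x"
    and x1: "x1 \<in> cball a r"
  show "w x1 \<le> h x1"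
  proof (rule ccontr)
    assume "\<not> w x1 \<le> h x1"
    \<comment> \<open>On the sphere the perturbation then equals half the gap
      \<open>w x1 - h x1\<close>, too little to reach the value of \<open>\<psi>\<close> at
      \<open>x1\<close>.\<close>
    define \<epsilon> where "\<epsilon> = (w x1 - h x1) / (2 * r\<^sup>2)"
    have \<epsilon>: "\<epsilon> > 0" "\<epsilon> * r\<^sup>2 < w x1 - h x1"
      using \<open>\<not> w x1 \<le> h x1\<close> r by (auto simp: \<epsilon>_def)
    define \<psi> where "\<psi> x = w x - h x + \<epsilon> * ((x - a) \<bullet> (x - a))" for x
    have "continuous_on (cball a r) \<psi>"
      unfolding \<psi>_def by (intro continuous_intros continuous_on_subset[OF cont sub] hc)
    then obtain x2 where x2: "x2 \<in> cball a r" "\<And>x. x \<in> cball a r \<Longrightarrow> \<psi> x \<le> \<psi> x2"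
      using continuous_attains_sup[of "cball a r" \<psi>] r by auto
    have "x2 \<notin> sphere a r"
    proof
      assume "x2 \<in> sphere a r"
      then have "w x2 \<le> h x2" "(x2 - a) \<bullet> (x2 - a) = r\<^sup>2"
        using bd by (auto simp: dist_norm norm_minus_commute power2_norm_eq_inner[symmetric])
      then have "\<psi> x2 \<le> \<epsilon> * r\<^sup>2" by (simp add: \<psi>_def)
      also have "\<dots> < w x1 - h x1" by (rule \<epsilon>)
      also have "\<dots> \<le> \<psi> x1" using \<epsilon> by (simp add: \<psi>_def)
      finally show False using x2(2)[OF x1] by simp
    qed
    then have b: "x2 \<in> ball a r" using x2(1) by (auto simp: sphere_def)
    have harm': "\<And>i x. x \<in> ball a r \<Longrightarrow> h differentiable (at x)"
      "\<And>i x. i \<in> Basis \<Longrightarrow> x \<in> ball a r \<Longrightarrow> partial_deriv i h differentiable (at x)"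
      "laplacian h x2 = 0"
      using harm b by (auto simp: harmonic_on_def C2_on_def)
    have "k i x2 - partial_deriv i (partial_deriv i h) x2 + 2 * \<epsilon> \<le> 0" if i: "i \<in> Basis" for i
    proof -
      obtain d where d: "d > 0" "ball x2 d \<subseteq> ball a r"
        using b open_ball open_contains_ball by blast
      have inb: "x2 + t *\<^sub>R i \<in> ball a r" if "\<bar>t\<bar> < d" for t
        using that i by (intro subsetD[OF d(2)]) (simp add: dist_norm)
      \<comment> \<open>The derivatives \<open>g\<close> are given at parameter 0 of the line
        through each point; restarting the line at \<open>x2 + t *\<^sub>R i\<close> turns them into
        derivatives at \<open>t\<close>.\<close>
      have shift: "((\<lambda>t. F (x2 + t *\<^sub>R i)) has_real_derivative D) (at t)"
        if "((\<lambda>s. F (x2 + t *\<^sub>R i + s *\<^sub>R i)) has_real_derivative D) (at 0)" for F t D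
        using DERIV_shift[of "\<lambda>t. F (x2 + t *\<^sub>R i)" D 0 t] that
        by (simp add: scaleR_left_distrib add.assoc add.commute[of _ t])
      have h1: "((\<lambda>t. h (x2 + t *\<^sub>R i)) has_real_derivative partial_deriv i h (x2 + t *\<^sub>R i)) (at t)"
        if "\<bar>t\<bar> < d" for t
        unfolding partial_deriv_def
        using harm'(1)[OF inb[OF that]] frechet_derivative_works has_derivative_line by blast
      have h2: "((\<lambda>t. partial_deriv i h (x2 + t *\<^sub>R i)) has_real_derivative
            partial_deriv i (partial_deriv i h) x2) (at 0)"
      proof -
        have "((partial_deriv i h) has_derivative frechet_derivative (partial_deriv i h) (at x2)) (at (x2 + 0 *\<^sub>R i))"
          using harm'(2)[OF i b] by (simp add: frechet_derivative_works)
        from has_derivative_line[OF this] show ?thesis by (simp only: partial_deriv_def[of i "partial_deriv i h"])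
      qed
      have quad: "((\<lambda>t. \<epsilon> * ((x2 + t *\<^sub>R i - a) \<bullet> (x2 + t *\<^sub>R i - a))) has_real_derivative
          2 * \<epsilon> * ((x2 + t *\<^sub>R i - a) \<bullet> i)) (at t)" for t
      proof -
        have "((\<lambda>t. \<epsilon> * ((x2 - a) \<bullet> (x2 - a) + 2 * t * ((x2 - a) \<bullet> i) + t\<^sup>2 * (i \<bullet> i))) has_real_derivative
          \<epsilon> * (2 * ((x2 - a) \<bullet> i) + 2 * t * (i \<bullet> i))) (at t)"
          by (auto intro!: derivative_eq_intros)
        then show ?thesis
          by (simp add: inner_simps inner_commute power2_eq_square algebra_simps)
      qed
      show ?thesis
      proof (rule second_derivative_nonpos_at_local_max[of d "\<lambda>t. \<psi> (x2 + t *\<^sub>R i)"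
            "\<lambda>t. g i (x2 + t *\<^sub>R i) - partial_deriv i h (x2 + t *\<^sub>R i) + 2 * \<epsilon> * ((x2 + t *\<^sub>R i - a) \<bullet> i)"])
        show "d > 0" by fact
        show "\<psi> (x2 + t *\<^sub>R i) \<le> \<psi> (x2 + 0 *\<^sub>R i)" if "\<bar>t\<bar> < d" for t
          using x2(2) inb[OF that] by (auto intro: less_imp_le)
        show "((\<lambda>t. \<psi> (x2 + t *\<^sub>R i)) has_real_derivative
           g i (x2 + t *\<^sub>R i) - partial_deriv i h (x2 + t *\<^sub>R i) + 2 * \<epsilon> * ((x2 + t *\<^sub>R i - a) \<bullet> i)) (at t)"
          if "\<bar>t\<bar> < d" for t
          unfolding \<psi>_def
          using inb[OF that] sub i
          by (intro DERIV_add DERIV_diff h1 quad that shift g) (auto intro: less_imp_le)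
        have "((\<lambda>t. 2 * \<epsilon> * ((x2 + t *\<^sub>R i - a) \<bullet> i)) has_real_derivative 2 * \<epsilon>) (at 0)"
          using i by (auto intro!: derivative_eq_intros simp: inner_simps)
        then show "((\<lambda>t. g i (x2 + t *\<^sub>R i) - partial_deriv i h (x2 + t *\<^sub>R i) + 2 * \<epsilon> * ((x2 + t *\<^sub>R i - a) \<bullet> i))
          has_real_derivative k i x2 - partial_deriv i (partial_deriv i h) x2 + 2 * \<epsilon>) (at 0)"
          using b sub i x2(1) by (intro DERIV_add DERIV_diff h2 k) auto
      qed
    qed
    then have "(\<Sum>i\<in>Basis. k i x2 - partial_deriv i (partial_deriv i h) x2 + 2 * \<epsilon>) \<le> 0"
      by (intro sum_nonpos) auto
    then have "(\<Sum>i\<in>Basis. k i x2) + real DIM('a) * (2 * \<epsilon>) \<le> 0"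
      using harm'(3) by (simp add: sum.distrib sum_subtractf laplacian_def)
    moreover have "real DIM('a) * (2 * \<epsilon>) > 0" using \<epsilon> by (simp add: DIM_positive)
    moreover have "0 \<le> (\<Sum>i\<in>Basis. k i x2)" using nonneg[of x2] x2(1) sub by blast
    ultimately show False by linarith
  qed
qed (rule U)

section \<open>Vanishing outside the essential support\<close>

lemma open_Compl_ess_support: "open (- ess_support f)"
  unfolding open_contains_ball
proof
  fix x assume "x \<in> - ess_support f"
  then obtain U where U: "open U" "x \<in> U" "AE y in lebesgue. y \<in> U \<longrightarrow> f y = 0"
    by (auto simp: ess_support_def)
  then have "U \<subseteq> - ess_support f" by (auto simp: ess_support_def)
  then show "\<exists>e>0. ball x e \<subseteq> - ess_support f"
    using U(1,2) unfolding open_contains_ball by (meson order_trans)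
qed

text \<open>The complement is a union of open sets, each carrying its own exceptional null set. By
  Lindelof countably many of them suffice, and countably many null sets still form a null
  set.\<close>

lemma AE_zero_outside_ess_support: "AE y in lebesgue. y \<notin> ess_support f \<longrightarrow> f y = 0"
proof -
  let ?F = "{U. open U \<and> (AE y in lebesgue. y \<in> U \<longrightarrow> f y = 0)}"
  obtain F where F: "F \<subseteq> ?F" "countable F" "\<Union>F = \<Union>?F"
    using Lindelof[of ?F] by auto
  have "AE y in lebesgue. \<forall>U\<in>F. y \<in> U \<longrightarrow> f y = 0"
    using F(1) by (subst AE_ball_countable[OF F(2)]) auto
  then show ?thesis
  proof eventually_elim
    case (elim y)
    have "- ess_support f = \<Union>?F" by (auto simp: ess_support_def)
    then show ?case using elim F(3) by (metis (no_types, lifting) ComplI UnionE)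
  qed
qed

subsection \<open>Weighted integrals over concentric balls\<close>

text \<open>The case distinction makes \<open>pospow 0\<close> the indicator of the half-line
  \<open>0 \<le> s\<close>, whereas \<open>max 0 s ^ 0\<close> would be 1 everywhere.\<close>

definition pospow :: "nat \<Rightarrow> real \<Rightarrow> real" where
  "pospow j s = (if 0 \<le> s then s ^ j else 0)"

lemma pospow_max: "pospow (Suc j) s = max 0 s ^ Suc j"
  by (auto simp: pospow_def max_def)

lemma pospow_nonneg: "0 \<le> pospow j s"
  by (simp add: pospow_def)

lemma pospow_Suc: "pospow (Suc j) s = s * pospow j s"
  by (simp add: pospow_def)

lemma pospow_le: "s \<le> s' \<Longrightarrow> s \<le> 1 \<Longrightarrow> pospow j s \<le> pospow 0 s'"
  by (auto simp: pospow_def power_le_one)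

lemma pospow_lipschitz:
  assumes "s \<le> 1" "s' \<le> 1"
  shows "\<bar>pospow (Suc j) s - pospow (Suc j) s'\<bar> \<le> real (Suc j) * \<bar>s - s'\<bar>"
proof -
  have "\<bar>pospow (Suc j) s - pospow (Suc j) s'\<bar> \<le> real (Suc j) * \<bar>max 0 s - max 0 s'\<bar>"
    using norm_power_diff[of "max 0 s" "max 0 s'" "Suc j"] assms
    unfolding pospow_max by simp
  also have "\<dots> \<le> real (Suc j) * \<bar>s - s'\<bar>"
    by (intro mult_left_mono) auto
  finally show ?thesis .
qed

lemma DERIV_pospow:
  assumes "j > 0 \<or> s \<noteq> 0"
  shows "(pospow (Suc j) has_real_derivative real (Suc j) * pospow j s) (at s)"
proof -
  consider "s > 0" | "s < 0" | "s = 0" "j > 0" using assms by linarith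
  then show ?thesis
  proof cases
    case 1
    have "((\<lambda>s. s ^ Suc j) has_real_derivative real (Suc j) * pospow j s) (at s)"
      using DERIV_pow[of "Suc j" s] 1 by (simp add: pospow_def)
    then show ?thesis
      by (rule has_field_derivative_transform_within_open[of _ _ _ "{0<..}"]) (use 1 in \<open>auto simp: pospow_def\<close>)
  next
    case 2
    have "((\<lambda>s. 0) has_real_derivative real (Suc j) * pospow j s) (at s)"
      using 2 by (auto intro!: derivative_eq_intros simp: pospow_def)
    then show ?thesis
      by (rule has_field_derivative_transform_within_open[of _ _ _ "{..<0}"]) (use 2 in \<open>auto simp: pospow_def\<close>)
  next
    case 3
    \<comment> \<open>At the corner the difference quotient of \<open>pospow (Suc j)\<close> is
      \<open>pospow j\<close>, which for \<open>j > 0\<close> is continuous with value 0; this is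
      Caratheodory's criterion.\<close>
    then obtain l where l: "j = Suc l" using gr0_implies_Suc by blast
    have "isCont (pospow j) 0"
      unfolding l pospow_max by (intro continuous_intros)
    then show ?thesis
      unfolding CARAT_DERIV using 3 l
      by (intro exI[of _ "pospow j"]) (auto simp: pospow_Suc)
  qed
qed

text \<open>An integral over the ball of squared radius \<open>a\<close>. With this parameter,
  differentiation in \<open>a\<close> merely lowers \<open>j\<close>, and \<open>j = 0\<close> is
  the unweighted integral of \<open>h\<close> over the ball.\<close>

definition ball_moment :: "nat \<Rightarrow> ('a::euclidean_space \<Rightarrow> real) \<Rightarrow> real \<Rightarrow> real" where
  "ball_moment j h a = (\<integral>w. pospow j (a - (norm w)\<^sup>2) * h w \<partial>lborel)"

lemma integrable_ball_moment:
  fixes h :: "'a::euclidean_space \<Rightarrow> real"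
  assumes h: "continuous_on (ball 0 1) h" and a: "a < 1"
  shows "integrable lborel (\<lambda>w. pospow j (a - (norm w)\<^sup>2) * h w)"
proof (cases "a < 0")
  case True
  then have "pospow j (a - (norm w)\<^sup>2) * h w = 0" for w :: 'a
    using zero_le_power2[of "norm w"] unfolding pospow_def by (smt (verit) mult_eq_0_iff)
  then have eq: "(\<lambda>w. pospow j (a - (norm w)\<^sup>2) * h w) = (\<lambda>_. 0)" by blast
  show ?thesis unfolding eq by simp
next
  case False
  have iff: "0 \<le> a - (norm w)\<^sup>2 \<longleftrightarrow> w \<in> cball 0 (sqrt a)" for w :: 'a
    using False real_le_rsqrt[of "norm w" a] sqrt_ge_absD[of "norm w" a] by auto
  have "cball (0::'a) (sqrt a) \<subseteq> ball 0 1"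
    using a real_sqrt_lt_1_iff[of a] by (auto simp del: real_sqrt_lt_1_iff)
  then have "continuous_on (cball (0::'a) (sqrt a)) (\<lambda>w. (a - (norm w)\<^sup>2) ^ j * h w)"
    by (intro continuous_intros continuous_on_subset[OF h])
  from borel_integrable_compact[OF compact_cball this] show ?thesis
    by (rule back_subst[of "integrable lborel"]) (simp add: fun_eq_iff pospow_def iff indicator_def del: diff_ge_0_iff_ge mem_cball)
qed

text \<open>Differentiation under the integral. The weight of order \<open>Suc j\<close> vanishes on
  the moving boundary, so no boundary term appears.\<close>

lemma DERIV_ball_moment:
  fixes h :: "'a::euclidean_space \<Rightarrow> real"
  assumes h: "continuous_on (ball 0 1) h" and a: "0 < a" "a < 1"
  shows "(ball_moment (Suc j) h has_real_derivative real (Suc j) * ball_moment j h a) (at a)"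
proof -
  \<comment> \<open>For parameters below \<open>b\<close> every weight is supported in one compact
    ball inside the open unit ball, so its indicator times \<open>\<bar>h w\<bar>\<close> is an
    integrable majorant.\<close>
  define b where "b = (1 + a) / 2"
  have b: "a < b" "b < 1" using a by (auto simp: b_def)
  let ?x = "\<lambda>w::'a. (norm w)\<^sup>2"
  have abs: "continuous_on (ball 0 1) (\<lambda>w. \<bar>h w\<bar>)" by (intro continuous_intros h)
  have le1: "a' - ?x w \<le> 1" if "a' < 1" for a' w
    using that zero_le_power2[of "norm w"] by linarith
  have "((\<lambda>a'. \<integral>w. pospow (Suc j) (a' - ?x w) * h w \<partial>lborel) has_derivative
      (\<lambda>d. d \<bullet> (\<integral>w. real (Suc j) * (pospow j (a - ?x w) * h w) \<partial>lborel))) (at a)"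
  proof (rule has_derivative_integral_dominated(2)[where r="b - a"
        and C="\<lambda>w. real (Suc j) * (pospow 0 (b - ?x w) * \<bar>h w\<bar>)"])
    show "integrable lborel (\<lambda>w. pospow (Suc j) (a' - ?x w) * h w)" if "a' \<in> ball a (b - a)" for a'
      using that b by (intro integrable_ball_moment[OF h]) (auto simp: dist_real_def)
    show "integrable lborel (\<lambda>w. real (Suc j) * (pospow 0 (b - ?x w) * \<bar>h w\<bar>))"
      by (intro integrable_mult_right integrable_ball_moment abs b)
    show "(\<lambda>w. real (Suc j) * (pospow j (a - ?x w) * h w)) \<in> borel_measurable lborel"
      by (intro borel_measurable_integrable integrable_mult_right integrable_ball_moment h a)
    show "AE w in lborel. norm (real (Suc j) * (pospow j (a - ?x w) * h w))
        \<le> real (Suc j) * (pospow 0 (b - ?x w) * \<bar>h w\<bar>)"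
    proof (intro AE_I2)
      fix w
      have "pospow j (a - ?x w) * \<bar>h w\<bar> \<le> pospow 0 (b - ?x w) * \<bar>h w\<bar>"
        using b le1[OF a(2)] by (intro mult_right_mono pospow_le) auto
      then show "norm (real (Suc j) * (pospow j (a - ?x w) * h w))
        \<le> real (Suc j) * (pospow 0 (b - ?x w) * \<bar>h w\<bar>)"
        using pospow_nonneg[of j "a - ?x w"] mult_left_mono[of _ _ "real (Suc j)"]
        by (simp add: abs_mult del: of_nat_Suc)
    qed
    show "AE w in lborel. \<forall>a'\<in>ball a (b - a).
        \<bar>pospow (Suc j) (a' - ?x w) * h w - pospow (Suc j) (a - ?x w) * h w\<bar>
        \<le> real (Suc j) * (pospow 0 (b - ?x w) * \<bar>h w\<bar>) * norm (a' - a)"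
    proof (intro AE_I2 ballI)
      fix w a' assume "a' \<in> ball a (b - a)"
      then have a': "a' < b" by (auto simp: dist_real_def)
      have "\<bar>pospow (Suc j) (a' - ?x w) - pospow (Suc j) (a - ?x w)\<bar>
          \<le> real (Suc j) * pospow 0 (b - ?x w) * \<bar>a' - a\<bar>"
      proof (cases "0 \<le> b - ?x w")
        case True
        then show ?thesis
          using pospow_lipschitz[OF le1[of a' w] le1[OF a(2), of w], of j] a' b
          by (simp add: pospow_def[of 0])
      next
        case False
        then show ?thesis using a' b by (simp add: pospow_def)
      qed
      then have "\<bar>pospow (Suc j) (a' - ?x w) - pospow (Suc j) (a - ?x w)\<bar> * \<bar>h w\<bar>
          \<le> real (Suc j) * pospow 0 (b - ?x w) * \<bar>a' - a\<bar> * \<bar>h w\<bar>"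
        by (intro mult_right_mono) auto
      then show "\<bar>pospow (Suc j) (a' - ?x w) * h w - pospow (Suc j) (a - ?x w) * h w\<bar>
        \<le> real (Suc j) * (pospow 0 (b - ?x w) * \<bar>h w\<bar>) * norm (a' - a)"
        by (simp only: left_diff_distrib[symmetric] abs_mult real_norm_def) (simp only: mult_ac)
    qed
    \<comment> \<open>For \<open>j = 0\<close> the integrand has a corner where
      \<open>|w|^2 = a\<close>; this sphere is a null set.\<close>
    have "sphere (0::'a) (sqrt a) \<in> null_sets lborel"
      using negligible_sphere[of "0::'a" "sqrt a"] by (auto simp: null_sets_completion_iff negligible_iff_null_sets)
    then have "AE w in lborel. w \<notin> sphere (0::'a) (sqrt a)"
      by (rule AE_not_in)
    then show "AE w in lborel. ((\<lambda>a'. pospow (Suc j) (a' - ?x w) * h w) has_derivative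
        (\<lambda>d. d \<bullet> (real (Suc j) * (pospow j (a - ?x w) * h w)))) (at a)"
    proof eventually_elim
      case (elim w)
      have "a - ?x w \<noteq> 0" using elim by (auto simp: real_sqrt_unique)
      then have "(pospow (Suc j) has_real_derivative real (Suc j) * pospow j (a - ?x w)) (at (a - ?x w))"
        by (intro DERIV_pospow) auto
      then have "((\<lambda>a'. pospow (Suc j) (a' - ?x w)) has_real_derivative real (Suc j) * pospow j (a - ?x w)) (at a)"
        using DERIV_shift[of "pospow (Suc j)" _ a "- ?x w"] by simp
      from DERIV_cmult_right[OF this, of "h w"] show ?case
        unfolding has_field_derivative_def by (rule has_derivative_eq_rhs) (simp add: fun_eq_iff)
    qed
  qed (use b in auto)
  then show ?thesis
    unfolding has_field_derivative_def ball_moment_def[abs_def]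
    by (rule has_derivative_eq_rhs) (simp add: fun_eq_iff)
qed

section \<open>Green's identity with radial weights, and the mean value property\<close>

lemma integrable_lborel_translate:
  fixes f :: "'a::euclidean_space \<Rightarrow> real"
  assumes "integrable lborel f"
  shows "integrable lborel (\<lambda>w. f (w + c))" "(\<integral>w. f (w + c) \<partial>lborel) = (\<integral>w. f w \<partial>lborel)"
proof -
  have f: "integrable (distr lborel borel ((+) c)) f" using assms by (simp add: lborel_distr_plus)
  then show "integrable lborel (\<lambda>w. f (w + c))"
    by (subst (asm) integrable_distr_eq) (use assms in \<open>auto simp: add.commute\<close>)
  show "(\<integral>w. f (w + c) \<partial>lborel) = (\<integral>w. f w \<partial>lborel)"
    using integral_distr[of "(+) c" lborel borel f] assms
    by (simp add: lborel_distr_plus add.commute)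
qed

lemma sum_Basis_inner_square: "(\<Sum>i\<in>Basis. (z \<bullet> i)\<^sup>2) = (norm z)\<^sup>2"
  unfolding power2_norm_eq_inner euclidean_inner[of z z] by (simp add: power2_eq_square)

lemma DERIV_line_norm_square:
  fixes w :: "'a::real_inner"
  shows "((\<lambda>t. (norm (w + t *\<^sub>R i))\<^sup>2) has_real_derivative 2 * (w \<bullet> i)) (at 0)"
proof -
  have "((\<lambda>t. w \<bullet> w + 2 * t * (w \<bullet> i) + t\<^sup>2 * (i \<bullet> i)) has_real_derivative 2 * (w \<bullet> i)) (at 0)"
    by (auto intro!: derivative_eq_intros)
  moreover have "(norm (w + t *\<^sub>R i))\<^sup>2 = w \<bullet> w + 2 * t * (w \<bullet> i) + t\<^sup>2 * (i \<bullet> i)" for t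
    unfolding power2_norm_eq_inner by (simp add: inner_simps inner_commute power2_eq_square)
  ultimately show ?thesis by (simp only:)
qed

text \<open>The derivative along a line integrates to zero because Lebesgue measure is translation
  invariant; this replaces the divergence theorem.\<close>

lemma integral_line_derivative_eq_0:
  fixes X D :: "'a::euclidean_space \<Rightarrow> real"
  assumes X: "integrable lborel X" and i: "norm i = 1"
    and deriv: "\<And>w. ((\<lambda>t. X (w + t *\<^sub>R i)) has_real_derivative D w) (at 0)"
    and D[measurable]: "D \<in> borel_measurable borel"
    and B: "\<And>w. \<bar>D w\<bar> \<le> B"
    and R: "\<And>w. R < norm w \<Longrightarrow> X w = 0" "\<And>w. R < norm w \<Longrightarrow> D w = 0"
  shows "(\<integral>w. D w \<partial>lborel) = 0"
proof -
  have shift: "((\<lambda>t. X (w + t *\<^sub>R i)) has_real_derivative D (w + s *\<^sub>R i)) (at s)" for w s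
    using DERIV_shift[of "\<lambda>t. X (w + t *\<^sub>R i)" "D (w + s *\<^sub>R i)" 0 s] deriv[of "w + s *\<^sub>R i"]
    by (simp add: scaleR_left_distrib add.assoc add.commute[of _ s])
  have "0 \<le> B" using B[of 0] by simp
  \<comment> \<open>For \<open>|t| < 1\<close> both \<open>X w\<close> and
    \<open>X (w + t *\<^sub>R i)\<close> vanish unless \<open>norm w \<le> R + 1\<close>.\<close>
  let ?C = "\<lambda>w::'a. indicator (cball 0 (R + 1)) w * B"
  have "((\<lambda>t. \<integral>w. X (w + t *\<^sub>R i) \<partial>lborel) has_derivative (\<lambda>h. h \<bullet> (\<integral>w. D w \<partial>lborel))) (at 0)"
  proof (rule has_derivative_integral_dominated(2)[where r=1 and C="?C"])
    show "integrable lborel (\<lambda>w. X (w + t *\<^sub>R i))" for t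
      by (rule integrable_lborel_translate[OF X])
    show "integrable lborel ?C"
      using borel_integrable_compact[OF compact_cball, of "0::'a" "R + 1" "\<lambda>_. B"] by simp
    show "AE w in lborel. norm (D w) \<le> ?C w"
      using B R(2) by (intro AE_I2) (force simp: indicator_def)
    show "AE w in lborel. ((\<lambda>t. X (w + t *\<^sub>R i)) has_derivative (\<lambda>h. h \<bullet> D w)) (at 0)"
      using deriv by (intro AE_I2) (simp add: has_field_derivative_def mult_commute_abs)
    show "AE w in lborel. \<forall>t\<in>ball 0 1. \<bar>X (w + t *\<^sub>R i) - X (w + 0 *\<^sub>R i)\<bar> \<le> ?C w * norm (t - 0)"
    proof (intro AE_I2 ballI)
      fix w and t :: real assume t: "t \<in> ball 0 1"
      show "\<bar>X (w + t *\<^sub>R i) - X (w + 0 *\<^sub>R i)\<bar> \<le> ?C w * norm (t - 0)"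
      proof (cases "norm w \<le> R + 1")
        case True
        have "norm (X (w + t *\<^sub>R i) - X (w + 0 *\<^sub>R i)) \<le> B * norm (t - 0)"
          using shift B by (intro field_differentiable_bound[of UNIV]) auto
        then show ?thesis using True by simp
      next
        case False
        have "norm w \<le> norm (w + t *\<^sub>R i) + norm (t *\<^sub>R i)"
          using norm_triangle_ineq4[of "w + t *\<^sub>R i" "t *\<^sub>R i"] by simp
        then have "R < norm (w + t *\<^sub>R i)" using False t i by simp
        then show ?thesis using False R(1) \<open>0 \<le> B\<close> by simp
      qed
    qed
  qed auto
  then have "((\<lambda>t. \<integral>w. X w \<partial>lborel) has_derivative (\<lambda>h. h \<bullet> (\<integral>w. D w \<partial>lborel))) (at (0::real))"
    by (simp add: integrable_lborel_translate(2)[OF X])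
  then have "(\<lambda>h::real. h \<bullet> (\<integral>w. D w \<partial>lborel)) = (\<lambda>h. 0)"
    by (rule has_derivative_unique) simp
  then show ?thesis
    by (metis inner_real_def mult_1)
qed

text \<open>The pure first and second derivatives along the axes are carried as explicit functions,
  so the Laplacian is the sum of the \<open>k i\<close> and products can be differentiated by
  formula.\<close>

definition C2_ball ::
  "('a::euclidean_space \<Rightarrow> real) \<Rightarrow> ('a \<Rightarrow> 'a \<Rightarrow> real) \<Rightarrow> ('a \<Rightarrow> 'a \<Rightarrow> real) \<Rightarrow> bool" where
  "C2_ball h g k \<longleftrightarrow>
     continuous_on (ball 0 1) h \<and>
     (\<forall>i\<in>Basis. continuous_on (ball 0 1) (g i) \<and> continuous_on (ball 0 1) (k i) \<and>
        (\<forall>w\<in>ball 0 1.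
           ((\<lambda>t. h (w + t *\<^sub>R i)) has_real_derivative g i w) (at 0) \<and>
           ((\<lambda>t. g i (w + t *\<^sub>R i)) has_real_derivative k i w) (at 0)))"

lemma C2_ballD:
  assumes "C2_ball h g k"
  shows "continuous_on (ball 0 1) h"
    and "i \<in> Basis \<Longrightarrow> continuous_on (ball 0 1) (g i)"
    and "i \<in> Basis \<Longrightarrow> continuous_on (ball 0 1) (k i)"
    and "w \<in> ball 0 1 \<Longrightarrow> i \<in> Basis \<Longrightarrow>
          ((\<lambda>t. h (w + t *\<^sub>R i)) has_real_derivative g i w) (at 0)"
    and "w \<in> ball 0 1 \<Longrightarrow> i \<in> Basis \<Longrightarrow>
          ((\<lambda>t. g i (w + t *\<^sub>R i)) has_real_derivative k i w) (at 0)"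
  using assms by (auto simp: C2_ball_def)

text \<open>Green's identity for \<open>h\<close> against the bump \<open>(a - |w|\<^sup>2)\<^sub>+\<^sup>3\<close>, whose Laplacian is
  \<open>24 a (a - |w|\<^sup>2)\<^sub>+ - (6 n + 24) (a - |w|\<^sup>2)\<^sub>+\<^sup>2\<close>.\<close>

lemma ball_moment_laplacian:
  fixes h :: "'a::euclidean_space \<Rightarrow> real"
  assumes C2: "C2_ball h g k" and a: "0 < a" "a < 1"
  shows "ball_moment 3 (\<lambda>w. \<Sum>i\<in>Basis. k i w) a =
     24 * a * ball_moment 1 h a - (6 * real DIM('a) + 24) * ball_moment 2 h a"
proof -
  note h = C2_ballD(1)[OF C2] and gc = C2_ballD(2)[OF C2] and kc = C2_ballD(3)[OF C2]
    and dh = C2_ballD(4)[OF C2] and dg = C2_ballD(5)[OF C2]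
  let ?s = "\<lambda>w::'a. a - (norm w)\<^sup>2"
  have zero: "pospow j (?s w) = 0" if "sqrt a < norm w" for j w
    using power_strict_mono[OF that, of 2] a by (simp add: pospow_def)
  have le1: "0 \<le> pospow j (?s w)" "pospow j (?s w) \<le> 1" for j w
    using pospow_le[of "?s w" 1 j] a zero_le_power2[of "norm w"]
    by (auto simp: pospow_nonneg pospow_def power_le_one)
  have sub: "cball (0::'a) (sqrt a) \<subseteq> ball 0 1"
    using a real_sqrt_lt_1_iff[of a] by (auto simp del: real_sqrt_lt_1_iff)
  have int: "integrable lborel (\<lambda>w. pospow j (?s w) * f w)" if "continuous_on (ball 0 1) f" for j f
    by (rule integrable_ball_moment[OF that a(2)])
  have main: "ball_moment 3 (k i) a =
      24 * ball_moment 1 (\<lambda>w. (w \<bullet> i)\<^sup>2 * h w) a - 6 * ball_moment 2 h a" if i: "i \<in> Basis" for i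
  proof -
    note gi = gc[OF i] and ki = kc[OF i]
    \<comment> \<open>With the bump \<open>P = pospow 3 (?s w)\<close>, whose partial derivative is
      \<open>- 6 (w \<bullet> i) pospow 2 (?s w)\<close>, this is the Green field component
      \<open>P \<partial>h - h \<partial>P\<close>. In its derivative \<open>D\<close> the mixed
      terms cancel.\<close>
    define X where "X w = pospow 3 (?s w) * g i w + pospow 2 (?s w) * (6 * (w \<bullet> i) * h w)" for w
    define D where "D w = pospow 3 (?s w) * k i w + (6 * (pospow 2 (?s w) * h w)
       - 24 * (pospow 1 (?s w) * ((w \<bullet> i)\<^sup>2 * h w)))" for w
    have c2: "continuous_on (ball 0 1) (\<lambda>w. (w \<bullet> i)\<^sup>2 * h w)" by (intro continuous_intros h)
    have Xint: "integrable lborel X"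
      unfolding X_def by (intro Bochner_Integration.integrable_add int gi continuous_intros h)
    have Dint: "integrable lborel D"
      unfolding D_def by (intro Bochner_Integration.integrable_add Bochner_Integration.integrable_diff
          integrable_mult_right int ki h c2)
    obtain B1 where B1: "\<And>w. w \<in> cball 0 (sqrt a) \<Longrightarrow> \<bar>k i w\<bar> \<le> B1"
      using compact_imp_bounded[OF compact_continuous_image[OF continuous_on_subset[OF ki sub] compact_cball]]
      unfolding bounded_iff by (metis image_eqI real_norm_def)
    obtain B2 where B2: "\<And>w. w \<in> cball 0 (sqrt a) \<Longrightarrow> \<bar>h w\<bar> \<le> B2"
      using compact_imp_bounded[OF compact_continuous_image[OF continuous_on_subset[OF h sub] compact_cball]]
      unfolding bounded_iff by (metis image_eqI real_norm_def)
    have Bpos: "0 \<le> B1" "0 \<le> B2" using B1[of 0] B2[of 0] a by auto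
    have bnd: "\<bar>D w\<bar> \<le> B1 + (6 * B2 + 24 * B2)" for w
    proof (cases "w \<in> cball 0 (sqrt a)")
      case True
      have "\<bar>w \<bullet> i\<bar> \<le> 1"
        using Basis_le_norm[OF i, of w] True sub by force
      then have w1: "(w \<bullet> i)\<^sup>2 \<le> 1" using abs_le_square_iff[of "w \<bullet> i" 1] by simp
      have "\<bar>pospow 3 (?s w) * k i w\<bar> \<le> 1 * B1" "\<bar>pospow 2 (?s w) * h w\<bar> \<le> 1 * B2"
        "\<bar>pospow 1 (?s w) * ((w \<bullet> i)\<^sup>2 * h w)\<bar> \<le> 1 * (1 * B2)"
        unfolding abs_mult using le1 B1[OF True] B2[OF True] Bpos w1
        by (intro mult_mono; simp)+
      then show ?thesis unfolding D_def by linarith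
    next
      case False
      then show ?thesis using Bpos by (simp add: D_def zero)
    qed
    have der: "((\<lambda>t. X (w + t *\<^sub>R i)) has_real_derivative D w) (at 0)" for w
    proof (cases "w \<in> ball 0 1")
      case True
      have ds: "((\<lambda>t. ?s (w + t *\<^sub>R i)) has_real_derivative - 2 * (w \<bullet> i)) (at 0)"
        using DERIV_diff[OF DERIV_const[of a] DERIV_line_norm_square[of w i]] by simp
      have dp: "((\<lambda>t. pospow (Suc j) (?s (w + t *\<^sub>R i))) has_real_derivative
          real (Suc j) * pospow j (?s w) * (- 2 * (w \<bullet> i))) (at 0)" if "j > 0" for j
        using DERIV_chain2[OF _ ds, of "pospow (Suc j)"] DERIV_pospow[of j "?s w"] that by simp
      have di: "((\<lambda>t. (w + t *\<^sub>R i) \<bullet> i) has_real_derivative 1) (at 0)"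
        using i by (auto intro!: derivative_eq_intros simp: inner_simps)
      note d3 = dp[of 2] and d2 = dp[of 1]
      have "((\<lambda>t. pospow 3 (?s (w + t *\<^sub>R i)) * g i (w + t *\<^sub>R i) +
            pospow 2 (?s (w + t *\<^sub>R i)) * (6 * ((w + t *\<^sub>R i) \<bullet> i) * h (w + t *\<^sub>R i)))
          has_real_derivative
          (3 * pospow 2 (?s w) * (- 2 * (w \<bullet> i))) * g i w + k i w * pospow 3 (?s w)
          + ((2 * pospow 1 (?s w) * (- 2 * (w \<bullet> i))) * (6 * (w \<bullet> i) * h w)
             + (6 * h w + g i w * (6 * (w \<bullet> i))) * pospow 2 (?s w))) (at 0)"
        using DERIV_add[OF DERIV_mult[OF d3 dg[OF True i]]
            DERIV_mult[OF d2 DERIV_mult[OF DERIV_cmult[OF di, of 6] dh[OF True i]]]]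
        by (simp add: numeral_3_eq_3 numeral_2_eq_2)
      then show ?thesis
        unfolding X_def D_def by (rule DERIV_cong) (simp add: power2_eq_square algebra_simps)
    next
      \<comment> \<open>Outside the open unit ball nothing is known about \<open>h\<close>, but the
        weights vanish on a neighbourhood of \<open>w\<close> because \<open>sqrt a < 1\<close>, and
        hence so does \<open>X\<close>.\<close>
      case False
      then have w: "1 \<le> norm w" by simp
      have "sqrt a < 1" using a by simp
      have "pospow j (?s w) = 0" for j
        using w \<open>sqrt a < 1\<close> by (intro zero) linarith
      then have "((\<lambda>t. 0) has_real_derivative D w) (at 0)"
        by (simp add: D_def)
      then show ?thesis
      proof (rule has_field_derivative_transform_within_open[of _ _ _ "ball 0 (1 - sqrt a)"])
        fix t :: real assume t: "t \<in> ball 0 (1 - sqrt a)"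
        have "norm w \<le> norm (w + t *\<^sub>R i) + norm (t *\<^sub>R i)"
          using norm_triangle_ineq4[of "w + t *\<^sub>R i" "t *\<^sub>R i"] by simp
        then have "sqrt a < norm (w + t *\<^sub>R i)" using w t i by simp
        then show "0 = X (w + t *\<^sub>R i)" by (simp add: X_def zero)
      qed (use \<open>sqrt a < 1\<close> in auto)
    qed
    have "(\<integral>w. D w \<partial>lborel) = 0"
    proof (rule integral_line_derivative_eq_0[OF Xint _ der _ bnd])
      show "norm i = 1" using i by simp
      show "D \<in> borel_measurable borel" using borel_measurable_integrable[OF Dint] by simp
      show "X w = 0" "D w = 0" if "sqrt a < norm w" for w
        using that by (simp_all add: X_def D_def zero)
    qed
    moreover have "(\<integral>w. D w \<partial>lborel) = ball_moment 3 (k i) a + (6 * ball_moment 2 h a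
       - 24 * ball_moment 1 (\<lambda>w. (w \<bullet> i)\<^sup>2 * h w) a)"
      unfolding D_def ball_moment_def using int[OF ki, of 3] int[OF h, of 2] int[OF c2, of 1] by simp
    ultimately show ?thesis by simp
  qed
  have "ball_moment 3 (\<lambda>w. \<Sum>i\<in>Basis. k i w) a = (\<Sum>i\<in>Basis. ball_moment 3 (k i) a)"
    unfolding ball_moment_def using int[OF kc, of _ 3]
    by (simp add: sum_distrib_left Bochner_Integration.integral_sum)
  also have "\<dots> = 24 * (\<Sum>i\<in>Basis. ball_moment 1 (\<lambda>w. (w \<bullet> i)\<^sup>2 * h w) a) - 6 * real DIM('a) * ball_moment 2 h a"
    by (simp add: main sum_subtractf sum_distrib_left)
  also have "(\<Sum>i\<in>Basis. ball_moment 1 (\<lambda>w. (w \<bullet> i)\<^sup>2 * h w) a) =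
      (\<integral>w. (\<Sum>i\<in>Basis. pospow 1 (?s w) * ((w \<bullet> i)\<^sup>2 * h w)) \<partial>lborel)"
    unfolding ball_moment_def
    by (subst Bochner_Integration.integral_sum) (auto intro!: int continuous_intros h)
  \<comment> \<open>Writing \<open>|w|^2 = a - (a - |w|^2)\<close> turns the factor
    \<open>|w|^2\<close> into one more power of the weight.\<close>
  also have "\<dots> = (\<integral>w. a * (pospow 1 (?s w) * h w) - pospow 2 (?s w) * h w \<partial>lborel)"
  proof (rule Bochner_Integration.integral_cong[OF refl])
    fix w
    have "(\<Sum>i\<in>Basis. pospow 1 (?s w) * ((w \<bullet> i)\<^sup>2 * h w)) = pospow 1 (?s w) * ((norm w)\<^sup>2 * h w)"
      by (simp only: sum_distrib_left[symmetric] sum_distrib_right[symmetric] sum_Basis_inner_square)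
    also have "\<dots> = a * (pospow 1 (?s w) * h w) - pospow 2 (?s w) * h w"
      by (simp add: numeral_2_eq_2 pospow_Suc algebra_simps)
    finally show "(\<Sum>i\<in>Basis. pospow 1 (?s w) * ((w \<bullet> i)\<^sup>2 * h w)) =
        a * (pospow 1 (?s w) * h w) - pospow 2 (?s w) * h w" .
  qed
  also have "\<dots> = a * ball_moment 1 h a - ball_moment 2 h a"
    unfolding ball_moment_def using int[OF h, of 1] int[OF h, of 2] by simp
  finally show ?thesis by (simp add: algebra_simps)
qed

text \<open>The factor \<open>a powr (- q)\<close> is integrating: its product with \<open>f\<close>
  has derivative zero.\<close>

lemma euler_ode_solution:
  fixes f :: "real \<Rightarrow> real"
  assumes f: "\<And>a. 0 < a \<Longrightarrow> a < 1 \<Longrightarrow> (f has_real_derivative f' a) (at a)"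
    and ode: "\<And>a. 0 < a \<Longrightarrow> a < 1 \<Longrightarrow> a * f' a = q * f a"
  obtains C where "\<And>a. 0 < a \<Longrightarrow> a < 1 \<Longrightarrow> f a = C * a powr q"
proof -
  let ?F = "\<lambda>a. f a * a powr (- q)"
  have "(?F has_real_derivative 0) (at a)" if "a \<in> {0<..<1}" for a
  proof -
    have a: "0 < a" "a < 1" using that by auto
    have "((\<lambda>a. a powr (- q)) has_real_derivative - q * a powr (- q - 1)) (at a)"
      using a by (auto intro!: derivative_eq_intros)
    from DERIV_mult[OF f[OF a] this] show ?thesis
    proof (rule DERIV_cong)
      have "a powr (- q) = a * a powr (- q - 1)"
        using a by (simp add: powr_diff)
      then have "f' a * a powr (- q) + - q * a powr (- q - 1) * f a = a powr (- q - 1) * (a * f' a - q * f a)"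
        by (simp add: algebra_simps)
      then show "f' a * a powr (- q) + - q * a powr (- q - 1) * f a = 0"
        using ode[OF a] by simp
    qed
  qed
  then have "?F a = ?F (1/2)" if "0 < a" "a < 1" for a
    using that DERIV_isconst3[of 0 1 a "1/2" ?F] by simp
  then have "f a = ?F (1/2) * a powr q" if "0 < a" "a < 1" for a
    using that by (simp add: powr_minus field_simps)
  then show ?thesis by (rule that)
qed

text \<open>For harmonic \<open>h\<close> the left side of Green's identity vanishes. The derivative
  of the second moment is twice the first, so what remains is an Euler equation for the second
  moment.\<close>

lemma ball_moment_2_harmonic:
  fixes h :: "'a::euclidean_space \<Rightarrow> real"
  assumes C2: "C2_ball h g k" and harm: "\<And>w. w \<in> ball 0 1 \<Longrightarrow> (\<Sum>i\<in>Basis. k i w) = 0"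
  obtains C where
    "\<And>a. 0 < a \<Longrightarrow> a < 1 \<Longrightarrow> ball_moment 2 h a = C * a powr (real DIM('a) / 2 + 2)"
proof (rule euler_ode_solution)
  fix a :: real assume a: "0 < a" "a < 1"
  show "(ball_moment 2 h has_real_derivative 2 * ball_moment 1 h a) (at a)"
    using DERIV_ball_moment[OF C2_ballD(1)[OF C2] a, of 1] by (simp add: numeral_2_eq_2)
  have "pospow 3 (a - (norm w)\<^sup>2) * (\<Sum>i\<in>Basis. k i w) = 0" for w :: 'a
  proof (cases "w \<in> ball 0 1")
    case True then show ?thesis by (simp add: harm)
  next
    case False
    then have "1 \<le> (norm w)\<^sup>2" using power_mono[of 1 "norm w" 2] by simp
    then show ?thesis using a by (simp add: pospow_def)
  qed
  then have "ball_moment 3 (\<lambda>w. \<Sum>i\<in>Basis. k i w) a = 0"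
    unfolding ball_moment_def by (simp only: Bochner_Integration.integral_zero)
  then show "a * (2 * ball_moment 1 h a) = (real DIM('a) / 2 + 2) * ball_moment 2 h a"
    using ball_moment_laplacian[OF C2 a] by (simp add: field_simps)
qed (auto intro: that)

lemma ball_moment_0_1:
  assumes "0 < a"
  shows "ball_moment 0 (\<lambda>w::'a::euclidean_space. 1) a = unit_ball_vol (real DIM('a)) * a powr (real DIM('a) / 2)"
proof -
  have "pospow 0 (a - (norm w)\<^sup>2) = indicator (cball 0 (sqrt a)) w" for w :: 'a
    using real_le_rsqrt[of "norm w" a] sqrt_ge_absD[of "norm w" a]
    by (auto simp: pospow_def indicator_def)
  then have "ball_moment 0 (\<lambda>w::'a. 1) a = measure lborel (cball (0::'a) (sqrt a))"
    by (simp add: ball_moment_def)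
  also have "\<dots> = unit_ball_vol (real DIM('a)) * sqrt a ^ DIM('a)"
    using assms by (intro content_cball) simp
  also have "sqrt a ^ DIM('a) = a powr (real DIM('a) / 2)"
    using assms by (simp add: powr_half_sqrt[symmetric] powr_powr powr_realpow[symmetric])
  finally show ?thesis .
qed

text \<open>The second moments of \<open>h\<close> and of the constant 1 are multiples of the same
  power of \<open>a\<close>. Comparing them on small balls, where \<open>h\<close> is close to
  \<open>h 0\<close>, shows that the ratio of the coefficients is \<open>h 0\<close>; two
  differentiations carry this down to the unweighted integrals.\<close>

lemma harmonic_mean_value:
  fixes h :: "'a::euclidean_space \<Rightarrow> real"
  assumes C2: "C2_ball h g k" and harm: "\<And>w. w \<in> ball 0 1 \<Longrightarrow> (\<Sum>i\<in>Basis. k i w) = 0"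
    and a: "0 < a" "a < 1"
  shows "ball_moment 0 h a = h 0 * unit_ball_vol (real DIM('a)) * a powr (real DIM('a) / 2)"
proof -
  let ?q = "real DIM('a) / 2 + 2" and ?u = "\<lambda>w::'a. 1::real"
  note hc = C2_ballD(1)[OF C2]
  have C2u: "C2_ball ?u (\<lambda>i w. 0) (\<lambda>i w. 0)" by (simp add: C2_ball_def)
  note uc = C2_ballD(1)[OF C2u]
  obtain C where C: "\<And>a. 0 < a \<Longrightarrow> a < 1 \<Longrightarrow> ball_moment 2 h a = C * a powr ?q"
    using ball_moment_2_harmonic[OF C2 harm] by blast
  obtain C1 where C1: "\<And>a. 0 < a \<Longrightarrow> a < 1 \<Longrightarrow> ball_moment 2 ?u a = C1 * a powr ?q"
    using ball_moment_2_harmonic[OF C2u] by auto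
  have close: "\<bar>C - h 0 * C1\<bar> \<le> \<epsilon> * C1" if eps: "\<epsilon> > 0" for \<epsilon>
  proof -
    have "isCont h 0" using hc by (simp add: continuous_on_eq_continuous_at)
    then have "\<forall>\<epsilon>>0. \<exists>\<delta>>0. \<forall>w. norm w < \<delta> \<longrightarrow> \<bar>h w - h 0\<bar> < \<epsilon>"
      unfolding continuous_at_eps_delta by (simp add: dist_real_def)
    then obtain \<delta> where \<delta>: "\<delta> > 0" "\<And>w. norm w < \<delta> \<Longrightarrow> \<bar>h w - h 0\<bar> < \<epsilon>"
      using eps by blast
    \<comment> \<open>The ball of squared radius \<open>b\<close> lies inside both the unit ball and
      the ball of radius \<open>\<delta>\<close>.\<close>
    define b where "b = min (1/2) (\<delta>\<^sup>2 / 2)"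
    have "0 < \<delta>\<^sup>2" using \<delta>(1) by simp
    then have b: "0 < b" "b < 1" "b < \<delta>\<^sup>2" unfolding b_def by linarith+
    note int = integrable_ball_moment[OF hc b(2), of 2] integrable_ball_moment[OF uc b(2), of 2]
    have "\<bar>ball_moment 2 h b - h 0 * ball_moment 2 ?u b\<bar> =
        \<bar>\<integral>w. pospow 2 (b - (norm w)\<^sup>2) * h w - h 0 * (pospow 2 (b - (norm w)\<^sup>2) * 1) \<partial>lborel\<bar>"
      unfolding ball_moment_def using int by simp
    also have "\<dots> \<le> (\<integral>w. \<epsilon> * (pospow 2 (b - (norm w)\<^sup>2) * ?u w) \<partial>lborel)"
    proof (rule integral_abs_bound_integral)
      show "\<bar>pospow 2 (b - (norm w)\<^sup>2) * h w - h 0 * (pospow 2 (b - (norm w)\<^sup>2) * 1)\<bar>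
          \<le> \<epsilon> * (pospow 2 (b - (norm w)\<^sup>2) * 1)" for w
      proof (cases "norm w < \<delta>")
        case True
        have "pospow 2 (b - (norm w)\<^sup>2) * \<bar>h w - h 0\<bar> \<le> pospow 2 (b - (norm w)\<^sup>2) * \<epsilon>"
          using \<delta>(2)[OF True] by (intro mult_left_mono pospow_nonneg) simp
        then show ?thesis
          using abs_mult[of "pospow 2 (b - (norm w)\<^sup>2)" "h w - h 0"] pospow_nonneg[of 2 "b - (norm w)\<^sup>2"]
          by (simp add: algebra_simps)
      next
        case False
        then have "\<delta>\<^sup>2 \<le> (norm w)\<^sup>2" using \<delta>(1) by (intro power_mono) auto
        then show ?thesis using b by (simp add: pospow_def)
      qed
    qed (use int in simp_all)
    also have "\<dots> = \<epsilon> * ball_moment 2 ?u b" unfolding ball_moment_def by simp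
    finally have "\<bar>C - h 0 * C1\<bar> * b powr ?q \<le> \<epsilon> * C1 * b powr ?q"
      using C[OF b(1,2)] C1[OF b(1,2)]
        abs_mult[of "C - h 0 * C1" "b powr ?q"] by (simp add: algebra_simps)
    then show ?thesis using b by simp
  qed
  have "C = h 0 * C1"
  proof (rule ccontr)
    assume ne: "C \<noteq> h 0 * C1"
    \<comment> \<open>The estimate with \<open>\<epsilon> = 1\<close> forces \<open>C1 > 0\<close>;
      then half of the ratio of \<open>\<bar>C - h 0 * C1\<bar>\<close> to \<open>C1\<close> is an
      \<open>\<epsilon>\<close> that violates it.\<close>
    have "0 < C1" using close[of 1] ne by auto
    then show False
      using close[of "\<bar>C - h 0 * C1\<bar> / (2 * C1)"] ne by auto
  qed
  then have m2: "ball_moment 2 h b = h 0 * ball_moment 2 ?u b" if "0 < b" "b < 1" for b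
    using C[OF that] C1[OF that] by simp
  \<comment> \<open>Differentiating an identity valid on the whole interval lowers the order of the
    moments by one.\<close>
  have step: "ball_moment j h b = h 0 * ball_moment j ?u b"
    if eq: "\<And>b. 0 < b \<Longrightarrow> b < 1 \<Longrightarrow> ball_moment (Suc j) h b = h 0 * ball_moment (Suc j) ?u b"
      and b: "0 < b" "b < 1" for j b
  proof -
    have "((\<lambda>b. h 0 * ball_moment (Suc j) ?u b) has_real_derivative h 0 * (real (Suc j) * ball_moment j ?u b)) (at b)"
      by (intro DERIV_cmult DERIV_ball_moment uc b)
    then have "(ball_moment (Suc j) h has_real_derivative h 0 * (real (Suc j) * ball_moment j ?u b)) (at b)"
      by (rule has_field_derivative_transform_within_open[of _ _ _ "{0<..<1}"]) (use b in \<open>auto simp: eq\<close>)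
    with DERIV_ball_moment[OF hc b, of j] have "real (Suc j) * ball_moment j h b = h 0 * (real (Suc j) * ball_moment j ?u b)"
      by (rule DERIV_unique)
    then have "real (Suc j) * ball_moment j h b = real (Suc j) * (h 0 * ball_moment j ?u b)"
      by (simp only: mult.left_commute)
    then show ?thesis by (metis mult_cancel_left of_nat_eq_0_iff nat.distinct(1))
  qed
  have "ball_moment 0 h a = h 0 * ball_moment 0 ?u a"
    using step[OF step] m2 a by (metis numeral_2_eq_2)
  then show ?thesis using ball_moment_0_1[OF a(1), where 'a='a] by simp
qed

subsection \<open>Moments of powers of the distance\<close>

definition inv_norm_pow :: "nat \<Rightarrow> 'a::real_normed_vector \<Rightarrow> real" where
  "inv_norm_pow q z = 1 / norm z ^ q"

lemma inv_norm_pow_nonneg: "0 \<le> inv_norm_pow q z"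
  by (simp add: inv_norm_pow_def)

text \<open>For \<open>q > 0\<close> it persists at the origin, where division by zero makes both
  sides 0, so it can be used under an integral without excluding a point.\<close>

lemma inv_norm_pow_add2: "(norm z)\<^sup>2 * inv_norm_pow (q + 2) z = inv_norm_pow q z" if "z \<noteq> 0 \<or> 0 < q"
  using that by (cases "z = 0") (simp_all add: inv_norm_pow_def power_add power2_eq_square)

lemma has_derivative_inv_norm_pow:
  fixes z :: "'a::real_inner"
  assumes "z \<noteq> 0"
  shows "(inv_norm_pow q has_derivative (\<lambda>h. h \<bullet> ((- real q * inv_norm_pow (q + 2) z) *\<^sub>R z))) (at z)"
proof -
  have "((\<lambda>x. 1 / x ^ q) has_real_derivative - real q / norm z ^ (q + 1)) (at (norm z))"
  proof (cases q)
    case (Suc m)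
    then show ?thesis using assms
      by (auto intro!: derivative_eq_intros simp: field_simps power_add) (cases m; simp)
  qed simp
  from DERIV_compose_FDERIV[OF this has_derivative_norm[OF assms]]
  show ?thesis
    unfolding inv_norm_pow_def[abs_def]
    by (rule has_derivative_eq_rhs)
      (use assms in \<open>auto simp: fun_eq_iff sgn_div_norm power_add field_simps power2_eq_square\<close>)
qed

lemma continuous_on_inv_norm_pow: "continuous_on S (\<lambda>x. inv_norm_pow q (f x))"
  if "continuous_on S f" "\<And>x. x \<in> S \<Longrightarrow> f x \<noteq> 0"
  using that unfolding inv_norm_pow_def by (intro continuous_intros) auto

lemma DERIV_line_inv_norm_pow:
  fixes e :: "'a::real_inner"
  assumes "e + w \<noteq> 0"
  shows "((\<lambda>t. inv_norm_pow q (e + (w + t *\<^sub>R i))) has_real_derivative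
     - real q * inv_norm_pow (q + 2) (e + w) * ((e + w) \<bullet> i)) (at 0)"
  using has_derivative_line[of "inv_norm_pow q" _ "e + w" 0 i] has_derivative_inv_norm_pow[OF assms, of q]
  by (simp add: add.assoc inner_commute)

context
  fixes e :: "'a::euclidean_space"
  assumes e: "norm e = 1"
begin

lemma shifted_nonzero: "w \<in> ball 0 1 \<Longrightarrow> e + w \<noteq> 0"
  using e by (auto simp: add_eq_0_iff)

lemma continuous_on_shifted: "continuous_on (ball 0 1) (\<lambda>w. inv_norm_pow q (e + w))"
  by (intro continuous_on_inv_norm_pow continuous_intros shifted_nonzero)

lemma C2_ball_inv_norm_pow:
  "C2_ball (\<lambda>w. inv_norm_pow q (e + w))
     (\<lambda>i w. - real q * inv_norm_pow (q + 2) (e + w) * ((e + w) \<bullet> i))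
     (\<lambda>i w. - real q * inv_norm_pow (q + 2) (e + w)
        + real q * (real q + 2) * inv_norm_pow (q + 4) (e + w) * ((e + w) \<bullet> i)\<^sup>2)"
  unfolding C2_ball_def
proof (intro conjI ballI)
  fix w i :: 'a assume w: "w \<in> ball 0 1" and i: "i \<in> Basis"
  note nz = shifted_nonzero[OF w]
  show "((\<lambda>t. inv_norm_pow q (e + (w + t *\<^sub>R i))) has_real_derivative
      - real q * inv_norm_pow (q + 2) (e + w) * ((e + w) \<bullet> i)) (at 0)"
    by (rule DERIV_line_inv_norm_pow[OF nz])
  have "((\<lambda>t. (e + (w + t *\<^sub>R i)) \<bullet> i) has_real_derivative 1) (at 0)"
    using i by (auto intro!: derivative_eq_intros simp: inner_simps)
  note DERIV_mult[OF DERIV_cmult[OF DERIV_line_inv_norm_pow[OF nz, of "q + 2" i], of "- real q"] this]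
  moreover have "q + 2 + 2 = q + 4" by simp
  ultimately show "((\<lambda>t. - real q * inv_norm_pow (q + 2) (e + (w + t *\<^sub>R i)) * ((e + (w + t *\<^sub>R i)) \<bullet> i)) has_real_derivative
      - real q * inv_norm_pow (q + 2) (e + w)
        + real q * (real q + 2) * inv_norm_pow (q + 4) (e + w) * ((e + w) \<bullet> i)\<^sup>2) (at 0)"
    by (elim DERIV_cong) (simp only:, simp add: power2_eq_square algebra_simps)
qed (intro continuous_intros continuous_on_shifted)+

text \<open>Summing the squares of the coordinates gives \<open>|e + w|^2\<close>, which lowers the
  exponent \<open>q + 4\<close> to \<open>q + 2\<close>. When \<open>q\<close> is the dimension, the
  factor is twice the dimension.\<close>

lemma laplacian_inv_norm_pow:
  assumes "w \<in> ball 0 1"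
  shows "(\<Sum>i\<in>Basis. - real q * inv_norm_pow (q + 2) (e + w)
        + real q * (real q + 2) * inv_norm_pow (q + 4) (e + w) * ((e + w) \<bullet> i)\<^sup>2) =
     real q * (real q + 2 - real DIM('a)) * inv_norm_pow (q + 2) (e + w)"
proof -
  have "(\<Sum>i\<in>Basis. - real q * inv_norm_pow (q + 2) (e + w)
        + real q * (real q + 2) * inv_norm_pow (q + 4) (e + w) * ((e + w) \<bullet> i)\<^sup>2) =
      of_nat DIM('a) * (- real q * inv_norm_pow (q + 2) (e + w))
        + real q * (real q + 2) * inv_norm_pow (q + 4) (e + w) * (norm (e + w))\<^sup>2"
    by (simp only: sum.distrib sum_constant sum_distrib_left[symmetric] sum_Basis_inner_square)
  also have "inv_norm_pow (q + 4) (e + w) * (norm (e + w))\<^sup>2 = inv_norm_pow (q + 2) (e + w)"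
    using inv_norm_pow_add2[of "e + w" "q + 2"]
    by (simp add: mult.commute add.assoc del: add_2_eq_Suc')
  then have "real q * (real q + 2) * inv_norm_pow (q + 4) (e + w) * (norm (e + w))\<^sup>2 =
      real q * (real q + 2) * inv_norm_pow (q + 2) (e + w)"
    by (simp only: mult.assoc)
  finally show ?thesis by (simp add: algebra_simps)
qed

end

lemma C2_ball_mult:
  assumes f: "C2_ball f g k" and f': "C2_ball f' g' k'"
  shows "C2_ball (\<lambda>w. f w * f' w) (\<lambda>i w. g i w * f' w + g' i w * f w)
     (\<lambda>i w. k i w * f' w + 2 * g i w * g' i w + k' i w * f w)"
  unfolding C2_ball_def
proof (intro conjI ballI)
  note D = C2_ballD[OF f] C2_ballD[OF f']
  fix i w :: 'a assume i: "i \<in> Basis"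
  show "continuous_on (ball 0 1) (\<lambda>w. g i w * f' w + g' i w * f w)"
    "continuous_on (ball 0 1) (\<lambda>w. k i w * f' w + 2 * g i w * g' i w + k' i w * f w)"
    using i by (intro continuous_intros D; assumption)+
  assume w: "w \<in> ball 0 1"
  note d = D(4)[OF w i] D(5)[OF w i] D(9)[OF w i] D(10)[OF w i]
  show "((\<lambda>t. f (w + t *\<^sub>R i) * f' (w + t *\<^sub>R i)) has_real_derivative g i w * f' w + g' i w * f w) (at 0)"
    using DERIV_mult[OF d(1,3)] by simp
  show "((\<lambda>t. g i (w + t *\<^sub>R i) * f' (w + t *\<^sub>R i) + g' i (w + t *\<^sub>R i) * f (w + t *\<^sub>R i))
      has_real_derivative k i w * f' w + 2 * g i w * g' i w + k' i w * f w) (at 0)"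
    by (rule DERIV_cong[OF DERIV_add[OF DERIV_mult[OF d(2,3)] DERIV_mult[OF d(4,1)]]]) simp
qed (intro continuous_intros C2_ballD(1)[OF f] C2_ballD(1)[OF f'])

lemma C2_ball_one_minus_norm_square:
  "C2_ball (\<lambda>w::'a::euclidean_space. 1 - (norm w)\<^sup>2) (\<lambda>i w. - 2 * (w \<bullet> i)) (\<lambda>i w. - 2)"
  unfolding C2_ball_def
proof (intro conjI ballI)
  fix i w :: 'a assume i: "i \<in> Basis"
  show "((\<lambda>t. 1 - (norm (w + t *\<^sub>R i))\<^sup>2) has_real_derivative - 2 * (w \<bullet> i)) (at 0)"
    using DERIV_diff[OF DERIV_const[of 1] DERIV_line_norm_square[of w i]] by simp
  show "((\<lambda>t. - 2 * ((w + t *\<^sub>R i) \<bullet> i)) has_real_derivative - 2) (at 0)"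
    using i by (auto intro!: derivative_eq_intros simp: inner_simps)
qed (intro continuous_intros)+

text \<open>\<open>(1 - |w|\<^sup>2) / |e + w|\<^sup>n\<close> is the Poisson kernel of the unit ball with pole \<open>- e\<close>.\<close>

lemma ball_moment_poisson_kernel:
  fixes e :: "'a::euclidean_space"
  assumes e: "norm e = 1" and a: "0 < a" "a < 1"
  shows "ball_moment 0 (\<lambda>w. (1 - (norm w)\<^sup>2) * inv_norm_pow DIM('a) (e + w)) a =
     unit_ball_vol (real DIM('a)) * a powr (real DIM('a) / 2)"
proof -
  let ?n = "DIM('a)"
  note C2 = C2_ball_mult[OF C2_ball_one_minus_norm_square C2_ball_inv_norm_pow[OF e, of ?n]]
  have "ball_moment 0 (\<lambda>w. (1 - (norm w)\<^sup>2) * inv_norm_pow ?n (e + w)) a =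
     (1 - (norm (0::'a))\<^sup>2) * inv_norm_pow ?n (e + 0) * unit_ball_vol (real ?n) * a powr (real ?n / 2)"
  proof (rule harmonic_mean_value[OF C2 _ a])
    fix w :: 'a assume w: "w \<in> ball 0 1"
    let ?N = "\<lambda>q. inv_norm_pow q (e + w)"
    let ?k = "\<lambda>i. - real ?n * ?N (?n + 2) + real ?n * (real ?n + 2) * ?N (?n + 4) * ((e + w) \<bullet> i)\<^sup>2"
    \<comment> \<open>This identity, which rests on \<open>norm e = 1\<close>, makes the gradient
      term and the Laplacian of the power cancel against the term from
      \<open>1 - |w|^2\<close>.\<close>
    have inner: "2 * (w \<bullet> (e + w)) + (1 - (norm w)\<^sup>2) = (norm (e + w))\<^sup>2"
      using e unfolding norm_eq_1 power2_norm_eq_inner by (simp add: inner_simps inner_commute)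
    have "(\<Sum>i\<in>Basis. - 2 * ?N ?n + 2 * (- 2 * (w \<bullet> i)) * (- real ?n * ?N (?n + 2) * ((e + w) \<bullet> i))
          + ?k i * (1 - (norm w)\<^sup>2)) =
        (\<Sum>i\<in>(Basis :: 'a set). - 2 * ?N ?n) + (\<Sum>i\<in>Basis. (4 * real ?n * ?N (?n + 2)) * ((w \<bullet> i) * ((e + w) \<bullet> i)))
          + (\<Sum>i\<in>Basis. ?k i) * (1 - (norm w)\<^sup>2)"
    proof -
      have "- 2 * ?N ?n + 2 * (- 2 * (w \<bullet> i)) * (- real ?n * ?N (?n + 2) * ((e + w) \<bullet> i))
          + ?k i * (1 - (norm w)\<^sup>2) =
        - 2 * ?N ?n + (4 * real ?n * ?N (?n + 2)) * ((w \<bullet> i) * ((e + w) \<bullet> i))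
          + ?k i * (1 - (norm w)\<^sup>2)" for i by simp
      then show ?thesis by (simp only: sum.distrib[of _ _ Basis] sum_distrib_right[symmetric])
    qed
    also have "\<dots> = - 2 * real ?n * ?N ?n + 4 * real ?n * ?N (?n + 2) * (w \<bullet> (e + w))
        + (real ?n * (real ?n + 2 - real ?n) * ?N (?n + 2)) * (1 - (norm w)\<^sup>2)"
      unfolding laplacian_inv_norm_pow[OF e w] by (simp only: sum_distrib_left[symmetric] euclidean_inner[symmetric] sum_constant)
    also have "\<dots> = - 2 * real ?n * ?N ?n
        + 2 * real ?n * ?N (?n + 2) * (2 * (w \<bullet> (e + w)) + (1 - (norm w)\<^sup>2))"
      by (simp only: distrib_left distrib_right) (simp del: inner_add_right)
    also have "\<dots> = 2 * real ?n * ((norm (e + w))\<^sup>2 * ?N (?n + 2) - ?N ?n)"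
      unfolding inner by (simp add: algebra_simps)
    also have "\<dots> = 0" using inv_norm_pow_add2[of "e + w" ?n] by simp
    finally show "(\<Sum>i\<in>Basis. - 2 * ?N ?n + 2 * (- 2 * (w \<bullet> i)) * (- real ?n * ?N (?n + 2) * ((e + w) \<bullet> i))
          + ?k i * (1 - (norm w)\<^sup>2)) = 0" .
  qed
  then show ?thesis using e by (simp add: inv_norm_pow_def)
qed

text \<open>Two tangent estimates, \<open>exp s \<ge> 1 + s\<close> and
  \<open>ln m \<le> m - 1\<close>, bound \<open>m powr (p - 1)\<close> from below by
  \<open>1 + (1 - p) (1 - m)\<close>; multiplying by \<open>m\<close> gives the claim.\<close>

lemma one_minus_powr_le:
  fixes m p :: real
  assumes m: "0 < m" and p: "p \<le> 1"
  shows "1 - m powr p \<le> (1 - m) * (1 - (1 - p) * m)"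
proof -
  have "1 + (1 - p) * (1 - m) \<le> 1 + (p - 1) * ln m"
    using mult_left_mono[OF ln_le_minus_one[OF m], of "1 - p"] p by (simp add: algebra_simps)
  also have "\<dots> \<le> exp ((p - 1) * ln m)" by (rule exp_ge_add_one_self)
  also have "\<dots> = m powr (p - 1)" using m by (simp add: powr_def)
  finally have "m * (1 + (1 - p) * (1 - m)) \<le> m * m powr (p - 1)"
    using m by (intro mult_left_mono) auto
  also have "m * m powr (p - 1) = m powr p" using m by (simp add: powr_diff)
  finally show ?thesis by (simp add: algebra_simps)
qed

section \<open>The moments of the extremal ball\<close>

context
  fixes e :: "'a::euclidean_space" and n \<kappa> :: real and F H :: "real \<Rightarrow> real"
  assumes e: "norm e = 1"
  defines "n \<equiv> real DIM('a)" and "\<kappa> \<equiv> unit_ball_vol n"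
    and "F \<equiv> ball_moment 0 (\<lambda>w. inv_norm_pow DIM('a) (e + w))"
    and "H \<equiv> ball_moment 1 (\<lambda>w. inv_norm_pow DIM('a) (e + w))"
begin

lemma n_pos: "0 < n"
  by (simp add: n_def)

text \<open>Splitting \<open>1 - |w|^2\<close> as \<open>(1 - a) + (a - |w|^2)\<close> decomposes
  the integral of the Poisson kernel over the ball. Since \<open>F\<close> is the derivative of
  \<open>H\<close>, this is a first-order linear equation for \<open>H\<close>.\<close>

lemma moments_relation:
  assumes a: "0 < a" "a < 1"
  shows "(1 - a) * F a + H a = \<kappa> * a powr (n / 2)"
proof -
  let ?N = "\<lambda>w. inv_norm_pow DIM('a) (e + w)"
  note int = integrable_ball_moment[OF continuous_on_shifted[OF e] a(2)]
  have "ball_moment 0 (\<lambda>w. (1 - (norm w)\<^sup>2) * ?N w) a =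
      (\<integral>w. (1 - a) * (pospow 0 (a - (norm w)\<^sup>2) * ?N w) + pospow 1 (a - (norm w)\<^sup>2) * ?N w \<partial>lborel)"
    unfolding ball_moment_def
    by (intro Bochner_Integration.integral_cong refl) (simp add: pospow_def algebra_simps)
  also have "\<dots> = (1 - a) * F a + H a"
    unfolding F_def H_def ball_moment_def using int[of 0 "DIM('a)"] int[of 1 "DIM('a)"] by simp
  finally show ?thesis
    using ball_moment_poisson_kernel[OF e a] by (simp add: n_def \<kappa>_def)
qed

lemma H_nonneg: "0 \<le> H a" and F_nonneg: "0 \<le> F a"
  unfolding H_def F_def ball_moment_def by (auto simp: pospow_nonneg inv_norm_pow_nonneg)

lemma DERIV_H: "(H has_real_derivative F a) (at a)" if "0 < a" "a < 1"
  using DERIV_ball_moment[OF continuous_on_shifted[OF e] that, of 0] by (simp add: H_def F_def)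

lemma DERIV_F:
  assumes a: "0 < a" "a < 1"
  shows "(F has_real_derivative \<kappa> * (n / 2 * a powr (n / 2 - 1)) / (1 - a)) (at a)"
proof -
  have eq: "(\<kappa> * b powr (n / 2) - H b) / (1 - b) = F b" if "b \<in> {0<..<1}" for b
    using moments_relation[of b] that by (simp add: field_simps)
  have "((\<lambda>b. (\<kappa> * b powr (n / 2) - H b) / (1 - b)) has_real_derivative
      ((\<kappa> * (n / 2 * a powr (n / 2 - 1)) - F a) * (1 - a) - (\<kappa> * a powr (n / 2) - H a) * (- 1)) / ((1 - a) * (1 - a))) (at a)"
    using a by (auto intro!: derivative_eq_intros DERIV_H)
  moreover have "\<kappa> * a powr (n / 2) - H a = (1 - a) * F a" using moments_relation[OF a] by simp
  then have "((\<kappa> * (n / 2 * a powr (n / 2 - 1)) - F a) * (1 - a) - (\<kappa> * a powr (n / 2) - H a) * (- 1)) / ((1 - a) * (1 - a))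
      = \<kappa> * (n / 2 * a powr (n / 2 - 1)) / (1 - a)"
  proof -
    assume "\<kappa> * a powr (n / 2) - H a = (1 - a) * F a"
    then have "(\<kappa> * (n / 2 * a powr (n / 2 - 1)) - F a) * (1 - a) - (\<kappa> * a powr (n / 2) - H a) * (- 1)
      = \<kappa> * (n / 2 * a powr (n / 2 - 1)) * (1 - a)" by (simp only:) (simp only: algebra_simps)
    then show ?thesis by (simp only:) (use a in simp)
  qed
  ultimately have "((\<lambda>b. (\<kappa> * b powr (n / 2) - H b) / (1 - b)) has_real_derivative
      \<kappa> * (n / 2 * a powr (n / 2 - 1)) / (1 - a)) (at a)" by simp
  then show ?thesis
    by (rule has_field_derivative_transform_within_open[of _ _ _ "{0<..<1}"]) (use a eq in auto)
qed

text \<open>Dividing by \<open>1 - b\<close> puts the equation for \<open>H\<close> into integrated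
  form. The difference \<open>D\<close> between the claimed bound and \<open>H\<close>, both divided
  by \<open>1 - b\<close>, tends to 0 at 0 and is nondecreasing by
  \<open>one_minus_powr_le\<close>.\<close>

lemma first_moment_bound:
  assumes n2: "2 \<le> n" and a: "0 < a" "a < 1"
  defines "m \<equiv> a powr (n / 2)"
  shows "H a \<le> \<kappa> * (m - (1 - a) * (n / 2 * ln ((1 - (1 - 2 / n) * m) / (1 - m))))"
proof -
  define p where "p = 2 / n"
  have p: "0 < p" "p \<le> 1" "n / 2 * p = 1" using n2 by (auto simp: p_def)
  have \<kappa>: "0 \<le> \<kappa>" by (simp add: \<kappa>_def n_def unit_ball_vol_nonneg)
  define M where "M b = b powr (n / 2)" for b :: real
  \<comment> \<open>By partial fractions, \<open>V\<close> is the primitive of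
    \<open>M' / ((1 - M) (1 - (1 - p) M))\<close>; the prefactor cancels because
    \<open>n / 2 * p = 1\<close>.\<close>
  define V where "V b = n / 2 * (ln (1 - (1 - p) * M b) - ln (1 - M b))" for b
  define D where "D b = \<kappa> * (M b / (1 - b) - V b) - H b / (1 - b)" for b
  have M: "0 < M b" "M b < 1" "0 < 1 - (1 - p) * M b" if "0 < b" "b < 1" for b
  proof -
    show M01: "0 < M b" "M b < 1" using that n2 powr_less_mono2[of "n / 2" b 1] by (auto simp: M_def)
    have "(1 - p) * M b \<le> 1 * M b" using M01 p by (intro mult_right_mono) auto
    then show "0 < 1 - (1 - p) * M b" using M01 by linarith
  qed
  have DERIV_D: "\<exists>y. (D has_real_derivative y) (at b) \<and> 0 \<le> y" if b: "0 < b" "b < 1" for b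
  proof -
    define M' where "M' = n / 2 * b powr (n / 2 - 1)"
    have M': "0 \<le> M'" using n2 by (simp add: M'_def)
    have dM: "(M has_real_derivative M') (at b)"
      unfolding M_def M'_def using b by (auto intro!: derivative_eq_intros)
    have ln_chain: "((\<lambda>x. ln (f x)) has_real_derivative 1 / f b * D) (at b)"
      if "(f has_real_derivative D) (at b)" "0 < f b" for f :: "real \<Rightarrow> real" and D
      using DERIV_chain2[where f=ln and g=f, OF DERIV_ln_divide[OF that(2)] that(1)] .
    have "((\<lambda>x. 1 - (1 - p) * M x) has_real_derivative - ((1 - p) * M')) (at b)"
      using DERIV_diff[OF DERIV_const[of 1] DERIV_cmult[OF dM, of "1 - p"]] by simp
    then have d1: "((\<lambda>x. ln (1 - (1 - p) * M x)) has_real_derivative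
        1 / (1 - (1 - p) * M b) * - ((1 - p) * M')) (at b)"
      by (rule ln_chain) (rule M(3)[OF b])
    have "((\<lambda>x. 1 - M x) has_real_derivative - M') (at b)"
      using DERIV_diff[OF DERIV_const[of 1] dM] by simp
    moreover have "0 < 1 - M b" using M(2)[OF b] by simp
    ultimately have d2: "((\<lambda>x. ln (1 - M x)) has_real_derivative 1 / (1 - M b) * - M') (at b)"
      by (rule ln_chain)
    have "n / 2 * (1 / (1 - (1 - p) * M b) * - ((1 - p) * M') - 1 / (1 - M b) * - M') =
        n / 2 * (M' / (1 - M b) - (1 - p) * M' / (1 - (1 - p) * M b))"
      by simp
    also have "M' / (1 - M b) - (1 - p) * M' / (1 - (1 - p) * M b) =
        (M' * (1 - (1 - p) * M b) - (1 - p) * M' * (1 - M b)) / ((1 - M b) * (1 - (1 - p) * M b))"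
      using M[OF b] by (intro diff_frac_eq) auto
    also have "M' * (1 - (1 - p) * M b) - (1 - p) * M' * (1 - M b) = p * M'"
      by (simp add: algebra_simps)
    also have "n / 2 * (p * M' / ((1 - M b) * (1 - (1 - p) * M b))) =
        (n / 2 * p) * (M' / ((1 - M b) * (1 - (1 - p) * M b)))"
      by simp
    finally have dV: "(V has_real_derivative M' / ((1 - M b) * (1 - (1 - p) * M b))) (at b)"
      using DERIV_cmult[OF DERIV_diff[OF d1 d2], of "n / 2"] p(3) unfolding V_def by simp
    have "(D has_real_derivative
        \<kappa> * ((M' * (1 - b) + M b) / ((1 - b) * (1 - b)) - M' / ((1 - M b) * (1 - (1 - p) * M b)))
        - (F b * (1 - b) + H b) / ((1 - b) * (1 - b))) (at b)"
      unfolding D_def using b by (auto intro!: derivative_eq_intros dM dV DERIV_H)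
    moreover have "F b * (1 - b) + H b = \<kappa> * M b"
      using moments_relation[OF b] by (simp add: M_def algebra_simps)
    then have "\<kappa> * ((M' * (1 - b) + M b) / ((1 - b) * (1 - b)) - M' / ((1 - M b) * (1 - (1 - p) * M b)))
        - (F b * (1 - b) + H b) / ((1 - b) * (1 - b)) =
        \<kappa> * (M' / (1 - b) - M' / ((1 - M b) * (1 - (1 - p) * M b)))"
    proof -
      assume *: "F b * (1 - b) + H b = \<kappa> * M b"
      have "\<kappa> * ((y * s + x) / (s * s) - T) - \<kappa> * x / (s * s) = \<kappa> * (y / s - T)"
        if "s \<noteq> 0" for x y s T :: real
        using that by (simp add: field_simps)
      then show ?thesis unfolding * using b by simp
    qed
    \<comment> \<open>Since \<open>M b powr p\<close> is \<open>b\<close>, the power inequality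
      compares exactly the two denominators in the derivative of \<open>D\<close>.\<close>
    moreover have "M b powr p = b" using b p(3) by (simp add: M_def powr_powr)
    then have "1 - b \<le> (1 - M b) * (1 - (1 - p) * M b)"
      using one_minus_powr_le[OF M(1)[OF b] p(2)] by simp
    then have "M' / ((1 - M b) * (1 - (1 - p) * M b)) \<le> M' / (1 - b)"
      using b M' by (intro divide_left_mono mult_pos_pos) (use M[OF b] in auto)
    ultimately show ?thesis using \<kappa> by auto
  qed
  have mono: "D b \<le> D a" if "0 < b" "b \<le> a" for b
  proof (rule DERIV_nonneg_imp_nondecreasing[OF that(2)])
    fix x assume "b \<le> x" "x \<le> a"
    then show "\<exists>y. (D has_real_derivative y) (at x) \<and> 0 \<le> y"
      using that a by (intro DERIV_D) linarith+
  qed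
  have limM: "(M \<longlongrightarrow> 0) (at_right 0)"
    unfolding M_def using n2
    by (intro tendsto_zero_powrI[where b="n / 2"] tendsto_const tendsto_ident_at)
      (auto simp: eventually_at_filter)
  \<comment> \<open>As \<open>F\<close> is nonnegative, the relation between the moments squeezes
    \<open>H\<close> between 0 and \<open>\<kappa> * M\<close>.\<close>
  have limH: "(H \<longlongrightarrow> 0) (at_right 0)"
  proof (rule tendsto_sandwich[of "\<lambda>_. 0" _ _ "\<lambda>b. \<kappa> * M b"])
    have "\<forall>\<^sub>F b in at_right (0::real). b \<in> {0<..<1}"
      by (rule eventually_at_rightI[of 0 1]) auto
    then show "\<forall>\<^sub>F b in at_right 0. H b \<le> \<kappa> * M b"
    proof eventually_elim
      case (elim b)
      then have "0 \<le> (1 - b) * F b" using F_nonneg[of b] by simp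
      then show ?case using moments_relation[of b] elim by (simp add: M_def)
    qed
    show "((\<lambda>b. \<kappa> * M b) \<longlongrightarrow> 0) (at_right 0)"
      using tendsto_mult_right_zero[OF limM] by simp
  qed (auto simp: H_nonneg)
  have "(D \<longlongrightarrow> \<kappa> * (0 / (1 - 0) - n / 2 * (ln (1 - (1 - p) * 0) - ln (1 - 0))) - 0 / (1 - 0)) (at_right 0)"
    unfolding D_def V_def by (intro tendsto_intros limM limH) auto
  then have "(D \<longlongrightarrow> 0) (at_right 0)" by simp
  moreover have "\<forall>\<^sub>F b in at_right 0. D b \<le> D a"
    by (rule eventually_at_rightI[of 0 a]) (use a mono in auto)
  ultimately have "0 \<le> D a"
    by (rule tendsto_upperbound) simp
  then have "H a / (1 - a) \<le> \<kappa> * (M a / (1 - a) - V a)" by (simp add: D_def)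
  then have "H a \<le> \<kappa> * (M a / (1 - a) - V a) * (1 - a)" using a by (simp add: pos_divide_le_eq)
  also have "\<dots> = \<kappa> * (M a - (1 - a) * V a)" using a by (simp add: field_simps)
  also have "V a = n / 2 * ln ((1 - (1 - 2 / n) * m) / (1 - m))"
    using M[OF a] by (simp add: V_def p_def ln_div m_def M_def)
  finally show ?thesis by (simp add: M_def m_def)
qed

text \<open>The inversion \<open>z \<mapsto> (1 - a) z / |z|\<^sup>2\<close> maps the ball around \<open>e\<close> of radius \<open>\<surd>a\<close> to itself;
  this is the corresponding identity of moments, obtained here without a change of variables.\<close>

lemma first_moment_inversion:
  assumes a: "0 < a" "a < 1"
  shows "(1 - a) * ball_moment 1 (\<lambda>w. inv_norm_pow (DIM('a) + 2) (e + w)) a = H a"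
proof -
  let ?G = "\<lambda>j. ball_moment j (\<lambda>w. inv_norm_pow (DIM('a) + 2) (e + w))"
  let ?H2 = "ball_moment 2 (\<lambda>w. inv_norm_pow DIM('a) (e + w))"
  note C2 = C2_ball_inv_norm_pow[OF e, of "DIM('a)"]
  \<comment> \<open>The Laplacian of \<open>|e + w|^(-n)\<close> is
    \<open>2 n |e + w|^(-n-2)\<close>, so Green's identity expresses the third moment of the latter
    kernel through moments of the former.\<close>
  have G3: "2 * n * ?G 3 b = 24 * b * H b - (6 * n + 24) * ?H2 b" if b: "0 < b" "b < 1" for b
  proof -
    let ?k = "\<lambda>i w. - real DIM('a) * inv_norm_pow (DIM('a) + 2) (e + w)
        + real DIM('a) * (real DIM('a) + 2) * inv_norm_pow (DIM('a) + 4) (e + w) * ((e + w) \<bullet> i)\<^sup>2"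
    have "pospow 3 (b - (norm w)\<^sup>2) * (\<Sum>i\<in>Basis. ?k i w) =
        2 * n * (pospow 3 (b - (norm w)\<^sup>2) * inv_norm_pow (DIM('a) + 2) (e + w))" for w
    proof (cases "w \<in> ball 0 1")
      case True
      show ?thesis unfolding laplacian_inv_norm_pow[OF e True] by (simp add: n_def)
    next
      case False
      then have "1 \<le> (norm w)\<^sup>2" using power_mono[of 1 "norm w" 2] by simp
      then show ?thesis using b by (simp add: pospow_def)
    qed
    then have "ball_moment 3 (\<lambda>w. \<Sum>i\<in>Basis. ?k i w) b = 2 * n * ?G 3 b"
      unfolding ball_moment_def by (simp only: integral_mult_right_zero)
    then show ?thesis using ball_moment_laplacian[OF C2 b] by (simp add: n_def H_def)
  qed
  \<comment> \<open>Differentiating an identity in the parameter lowers the order of the moment; two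
    applications lead from order 3 to order 1.\<close>
  have step: "c * (real (Suc j) * ?G j b) = R' b"
    if eq: "\<And>b. 0 < b \<Longrightarrow> b < 1 \<Longrightarrow> c * ?G (Suc j) b = R b"
      and R: "(R has_real_derivative R' b) (at b)" and b: "0 < b" "b < 1" for b c j R R'
  proof -
    have "((\<lambda>b. c * ?G (Suc j) b) has_real_derivative c * (real (Suc j) * ?G j b)) (at b)"
      by (intro DERIV_cmult DERIV_ball_moment continuous_on_shifted e b)
    then have "(R has_real_derivative c * (real (Suc j) * ?G j b)) (at b)"
      by (rule has_field_derivative_transform_within_open[of _ _ _ "{0<..<1}"]) (use b eq in auto)
    then show ?thesis using R by (rule DERIV_unique)
  qed
  have dH2: "(?H2 has_real_derivative 2 * H b) (at b)" if "0 < b" "b < 1" for b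
    using DERIV_ball_moment[OF continuous_on_shifted[OF e] that, of 1] by (simp add: H_def numeral_2_eq_2)
  have G2: "2 * n * (3 * ?G 2 b) = 24 * H b + 24 * b * F b - (6 * n + 24) * (2 * H b)"
    if b: "0 < b" "b < 1" for b
  proof -
    have "((\<lambda>b. 24 * b * H b - (6 * n + 24) * ?H2 b) has_real_derivative
        24 * H b + 24 * b * F b - (6 * n + 24) * (2 * H b)) (at b)"
      using b by (auto intro!: derivative_eq_intros DERIV_H dH2)
    from step[where c="2 * n" and j=2 and R="\<lambda>b. 24 * b * H b - (6 * n + 24) * ?H2 b"
        and R'="\<lambda>b. 24 * H b + 24 * b * F b - (6 * n + 24) * (2 * H b)", OF _ this b] G3
    show ?thesis by (simp add: numeral_3_eq_3 numeral_2_eq_2)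
  qed
  have G2': "6 * n * ?G (Suc 1) b = 24 * H b + 24 * b * F b - (6 * n + 24) * (2 * H b)"
    if b: "0 < b" "b < 1" for b
    using G2[OF b] by (simp only: Suc_1)
  let ?F' = "\<kappa> * (n / 2 * a powr (n / 2 - 1)) / (1 - a)"
  have "((\<lambda>b. 24 * H b + 24 * b * F b - (6 * n + 24) * (2 * H b)) has_real_derivative
      24 * F a + (24 * F a + 24 * a * ?F') - (6 * n + 24) * (2 * F a)) (at a)"
    using a by (auto intro!: derivative_eq_intros DERIV_H DERIV_F)
  from step[where c="6 * n" and j=1 and R="\<lambda>b. 24 * H b + 24 * b * F b - (6 * n + 24) * (2 * H b)"
      and R'="\<lambda>a. 24 * F a + (24 * F a + 24 * a * (\<kappa> * (n / 2 * a powr (n / 2 - 1)) / (1 - a))) - (6 * n + 24) * (2 * F a)", OF G2' this a]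
  have "6 * n * (2 * ?G 1 a) = 24 * F a + (24 * F a + 24 * a * ?F') - (6 * n + 24) * (2 * F a)"
    by (simp add: numeral_2_eq_2)
  also have "24 * a * ?F' = 12 * n * (\<kappa> * a powr (n / 2)) / (1 - a)"
  proof -
    have "24 * a * (\<kappa> * (n / 2 * X) / (1 - a)) = 12 * n * (\<kappa> * (a * X)) / (1 - a)" for X
      using a by (auto simp: divide_simps algebra_simps)
    moreover have "a * a powr (n / 2 - 1) = a powr (n / 2)"
      using a by (simp add: powr_diff)
    ultimately show ?thesis by (simp only:)
  qed
  \<comment> \<open>The terms \<open>48 * F a\<close> cancel, leaving \<open>12 * n\<close> as a
    common factor.\<close>
  also have "24 * F a + (24 * F a + 12 * n * (\<kappa> * a powr (n / 2)) / (1 - a)) - (6 * n + 24) * (2 * F a) =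
      12 * n * (\<kappa> * a powr (n / 2) / (1 - a) - F a)"
    by (simp add: algebra_simps)
  finally have "?G 1 a = \<kappa> * a powr (n / 2) / (1 - a) - F a"
    using n_pos by simp
  then have "(1 - a) * ?G 1 a = \<kappa> * a powr (n / 2) - (1 - a) * F a"
    using a by (simp add: right_diff_distrib)
  then show ?thesis using moments_relation[OF a] by simp
qed

end

subsection \<open>The gradient inequality\<close>

lemma borel_measurable_inv_norm_pow[measurable]:
  "inv_norm_pow q \<in> borel_measurable (borel :: 'a::real_normed_vector measure)"
  unfolding inv_norm_pow_def[abs_def] by measurable

lemma lborel_integral_affine:
  fixes f :: "'a::euclidean_space \<Rightarrow> real"
  assumes f[measurable]: "f \<in> borel_measurable borel" and c: "c \<noteq> 0"
  shows "(\<integral>x. f x \<partial>lborel) = \<bar>c\<bar> ^ DIM('a) * (\<integral>x. f (t + c *\<^sub>R x) \<partial>lborel)"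
    and "integrable lborel (\<lambda>x. f (t + c *\<^sub>R x)) \<Longrightarrow> integrable lborel f"
proof -
  show "(\<integral>x. f x \<partial>lborel) = \<bar>c\<bar> ^ DIM('a) * (\<integral>x. f (t + c *\<^sub>R x) \<partial>lborel)"
    by (subst lborel_affine[OF c, of t]) (simp add: integral_density integral_distr)
  show "integrable lborel f" if "integrable lborel (\<lambda>x. f (t + c *\<^sub>R x))"
    by (subst lborel_affine[OF c, of t]) (use that in \<open>simp add: integrable_density integrable_distr_eq\<close>)
qed

text \<open>The superlevel sets of \<open>y \<mapsto> 2 \<sigma> (y \<bullet> e) - \<sigma>\<^sup>2 - (1 - a) |y|\<^sup>2\<close> are balls; the extremal one
  is a dilate of the ball around \<open>e\<close> of radius \<open>\<surd>a\<close>.\<close>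

lemma extremal_ball_integral:
  fixes e x :: "'a::euclidean_space"
  assumes e: "norm e = 1" and a: "0 < a" "a < 1" and \<sigma>: "0 < \<sigma>"
  defines "f \<equiv> \<lambda>\<zeta>. inv_norm_pow (DIM('a) + 2) (x - \<zeta>) *
     max 0 (2 * \<sigma> * ((x - \<zeta>) \<bullet> e) - \<sigma>\<^sup>2 - (1 - a) * (norm (x - \<zeta>))\<^sup>2)"
  shows "integrable lebesgue f"
    and "(\<integral>\<zeta>. f \<zeta> \<partial>lebesgue) = ball_moment 1 (\<lambda>w. inv_norm_pow DIM('a) (e + w)) a"
proof -
  define b where "b = 1 - a"
  have b: "0 < b" using a by (simp add: b_def)
  \<comment> \<open>The superlevel set in \<open>y = x - \<zeta>\<close> is the ball with centre
    \<open>r *\<^sub>R e\<close> and radius \<open>r * sqrt a\<close>; the substitution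
    \<open>y = r *\<^sub>R (e + w)\<close> normalises it.\<close>
  define r where "r = \<sigma> / b"
  have r: "0 < r" using b \<sigma> by (simp add: r_def)
  have f[measurable]: "f \<in> borel_measurable borel" unfolding f_def by measurable
  let ?g = "\<lambda>w. pospow 1 (a - (norm w)\<^sup>2) * inv_norm_pow (DIM('a) + 2) (e + w)"
  \<comment> \<open>The kernel scales by \<open>r^(-n-2)\<close> and the quadratic form becomes
    \<open>b r^2 (a - |w|^2)\<close>; the remaining \<open>r^(-n)\<close> is later cancelled by the
    Jacobian.\<close>
  have eq: "f ((x - r *\<^sub>R e) + (- r) *\<^sub>R w) = b / r ^ DIM('a) * ?g w" for w
  proof -
    have y: "x - ((x - r *\<^sub>R e) + (- r) *\<^sub>R w) = r *\<^sub>R (e + w)" by (simp add: algebra_simps)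
    have ee: "e \<bullet> e = 1" using e by (simp add: norm_eq_1)
    have n2: "(norm (e + w))\<^sup>2 = 1 + 2 * (e \<bullet> w) + (norm w)\<^sup>2"
      unfolding power2_norm_eq_inner using ee by (simp add: inner_simps inner_commute)
    have "2 * \<sigma> * ((r *\<^sub>R (e + w)) \<bullet> e) - \<sigma>\<^sup>2 - b * (norm (r *\<^sub>R (e + w)))\<^sup>2 =
        2 * \<sigma> * r * (1 + e \<bullet> w) - \<sigma>\<^sup>2 - b * r\<^sup>2 * (1 + 2 * (e \<bullet> w) + (norm w)\<^sup>2)"
      using ee n2 r by (simp add: inner_simps inner_commute power_mult_distrib)
    also have "\<dots> = b * r\<^sup>2 * (2 * (1 + e \<bullet> w) - b - (1 + 2 * (e \<bullet> w) + (norm w)\<^sup>2))"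
      using b by (simp add: r_def field_simps power2_eq_square)
    also have "\<dots> = b * r\<^sup>2 * (a - (norm w)\<^sup>2)" by (simp add: b_def)
    finally have "max 0 (2 * \<sigma> * ((r *\<^sub>R (e + w)) \<bullet> e) - \<sigma>\<^sup>2 - b * (norm (r *\<^sub>R (e + w)))\<^sup>2) =
        max 0 (b * r\<^sup>2 * (a - (norm w)\<^sup>2))" by simp
    also have "\<dots> = b * r\<^sup>2 * pospow 1 (a - (norm w)\<^sup>2)"
    proof -
      have "max 0 (c * s) = c * pospow 1 s" if "0 < c" for c s
        using that by (auto simp: pospow_def max_def zero_le_mult_iff)
      then show ?thesis using mult_pos_pos[OF b zero_less_power[OF r, of 2]] by blast
    qed
    finally have "f ((x - r *\<^sub>R e) + (- r) *\<^sub>R w) =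
        inv_norm_pow (DIM('a) + 2) (r *\<^sub>R (e + w)) * (b * r\<^sup>2 * pospow 1 (a - (norm w)\<^sup>2))"
      unfolding f_def y b_def[symmetric] by simp
    also have "inv_norm_pow (DIM('a) + 2) (r *\<^sub>R (e + w)) = inv_norm_pow (DIM('a) + 2) (e + w) / (r ^ DIM('a) * r\<^sup>2)"
      using r by (simp add: inv_norm_pow_def power_mult_distrib power_add power2_eq_square)
    finally show ?thesis using r by simp
  qed
  have int: "integrable lborel ?g"
    by (intro integrable_ball_moment continuous_on_shifted e a)
  have "integrable lborel f"
  proof (rule lborel_integral_affine(2)[OF f, of "- r" "x - r *\<^sub>R e"])
    show "integrable lborel (\<lambda>w. f ((x - r *\<^sub>R e) + (- r) *\<^sub>R w))"
      unfolding eq by (rule integrable_mult_right[OF int])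
  qed (use r in simp)
  then show "integrable lebesgue f" by (simp add: integrable_completion)
  have "(\<integral>\<zeta>. f \<zeta> \<partial>lebesgue) = (\<integral>\<zeta>. f \<zeta> \<partial>lborel)" by (simp add: integral_completion)
  also have "\<dots> = r ^ DIM('a) * (\<integral>w. b / r ^ DIM('a) * ?g w \<partial>lborel)"
    using lborel_integral_affine(1)[OF f, of "- r" "x - r *\<^sub>R e"] r by (simp only: eq) simp
  also have "\<dots> = b * ball_moment 1 (\<lambda>w. inv_norm_pow (DIM('a) + 2) (e + w)) a"
    using r by (simp add: ball_moment_def)
  \<comment> \<open>The factor \<open>b = 1 - a\<close> is exactly what the inversion identity
    absorbs.\<close>
  also have "\<dots> = ball_moment 1 (\<lambda>w. inv_norm_pow DIM('a) (e + w)) a"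
    unfolding b_def by (rule first_moment_inversion[OF e a])
  finally show "(\<integral>\<zeta>. f \<zeta> \<partial>lebesgue) = ball_moment 1 (\<lambda>w. inv_norm_pow DIM('a) (e + w)) a" .
qed

text \<open>With \<open>a\<close> matched to \<open>u\<close>, the comparison with the extremal ball
  bounds \<open>2 \<sigma> |B| - \<sigma>^2 A\<close> by \<open>\<kappa> m\<close> for every
  \<open>\<sigma> > 0\<close>, since \<open>(1 - a) u\<close> occurs on both sides. The best
  \<open>\<sigma>\<close> turns the left side into \<open>|B|^2 / A\<close>.\<close>

lemma gradient_inequality:
  fixes \<rho> :: "'a::euclidean_space \<Rightarrow> real" and x :: 'a
  assumes n2: "2 \<le> DIM('a)"
    and \<rho>: "\<And>\<zeta>. 0 \<le> \<rho> \<zeta>" "\<And>\<zeta>. \<rho> \<zeta> \<le> 1"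
    and intu: "integrable lebesgue (\<lambda>\<zeta>. \<rho> \<zeta> * inv_norm_pow DIM('a) (x - \<zeta>))"
    and intA: "integrable lebesgue (\<lambda>\<zeta>. \<rho> \<zeta> * inv_norm_pow (DIM('a) + 2) (x - \<zeta>))"
    and intB: "integrable lebesgue (\<lambda>\<zeta>. (\<rho> \<zeta> * inv_norm_pow (DIM('a) + 2) (x - \<zeta>)) *\<^sub>R (x - \<zeta>))"
  defines "u \<equiv> \<integral>\<zeta>. \<rho> \<zeta> * inv_norm_pow DIM('a) (x - \<zeta>) \<partial>lebesgue"
    and "A \<equiv> \<integral>\<zeta>. \<rho> \<zeta> * inv_norm_pow (DIM('a) + 2) (x - \<zeta>) \<partial>lebesgue"
    and "B \<equiv> \<integral>\<zeta>. (\<rho> \<zeta> * inv_norm_pow (DIM('a) + 2) (x - \<zeta>)) *\<^sub>R (x - \<zeta>) \<partial>lebesgue"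
    and "n \<equiv> real DIM('a)" and "\<kappa> \<equiv> unit_ball_vol (real DIM('a))"
  defines "E \<equiv> exp (- (2 / n) * (u / \<kappa>))"
  assumes u: "0 < u"
  shows "(norm B)\<^sup>2 \<le> \<kappa> * ((1 - E) / (1 - (1 - 2 / n) * E)) * A"
proof -
  have "0 \<le> \<rho> \<zeta> * inv_norm_pow (DIM('a) + 2) (x - \<zeta>)" for \<zeta>
    by (simp add: \<rho> inv_norm_pow_nonneg)
  then have A0: "0 \<le> A" unfolding A_def by simp
  define p where "p = 2 / n"
  have n: "2 \<le> n" using n2 by (simp add: n_def)
  have p: "0 < p" "p \<le> 1" "n / 2 * p = 1" using n by (auto simp: p_def)
  have \<kappa>: "0 < \<kappa>" by (simp add: \<kappa>_def unit_ball_vol_pos)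
  have E: "0 < E" "E < 1" using u \<kappa> p(1) unfolding E_def p_def[symmetric] by (auto intro: mult_pos_pos)
  have qE: "(1 - p) * E < 1"
    using mult_right_mono[of "1 - p" 1 E] p E by linarith
  \<comment> \<open>This solves \<open>(1 - (1 - p) m) / (1 - m) = 1 / E\<close>, so the logarithmic
    term of \<open>first_moment_bound\<close> becomes \<open>u / \<kappa>\<close>.\<close>
  define m where "m = (1 - E) / (1 - (1 - p) * E)"
  have m1: "1 - m = p * E / (1 - (1 - p) * E)" "1 - (1 - p) * m = p / (1 - (1 - p) * E)"
    using qE by (simp_all add: m_def field_simps)
  have m: "0 < m" "m < 1"
  proof -
    show "0 < m" using E qE by (simp add: m_def)
    have "0 < 1 - m" unfolding m1 using E qE p by simp
    then show "m < 1" by simp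
  qed
  show ?thesis
  proof (cases "B = 0")
    case True
    have "0 \<le> \<kappa> * m * A" using A0 m(1) \<kappa> by simp
    then show ?thesis using True unfolding m_def p_def by simp
  next
    case False
    define e where "e = B /\<^sub>R norm B"
    have e: "norm e = 1" "B \<bullet> e = norm B"
      using False by (simp_all add: e_def power2_norm_eq_inner[symmetric] power2_eq_square)
    define a where "a = m powr p"
    have a: "0 < a" "a < 1" "a powr (n / 2) = m"
      using m p powr_less_mono2[of p m 1] by (auto simp: a_def powr_powr mult.commute)
    have "n / 2 * ln ((1 - (1 - 2 / n) * m) / (1 - m)) = n / 2 * ln (1 / E)"
      unfolding p_def[symmetric] m1 using E p qE by simp
    also have "\<dots> = n / 2 * p * (u / \<kappa>)"
      by (simp add: E_def ln_div p_def)
    finally have "n / 2 * ln ((1 - (1 - 2 / n) * m) / (1 - m)) = u / \<kappa>"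
      unfolding p(3) by simp
    with first_moment_bound[OF e(1) _ a(1,2)] n a(3)
    have "ball_moment 1 (\<lambda>w. inv_norm_pow DIM('a) (e + w)) a \<le> \<kappa> * (m - (1 - a) * (u / \<kappa>))"
      by (simp add: n_def \<kappa>_def)
    also have "\<dots> = \<kappa> * m - (1 - a) * u" using \<kappa> by (simp add: field_simps)
    finally have H: "ball_moment 1 (\<lambda>w. inv_norm_pow DIM('a) (e + w)) a \<le> \<kappa> * m - (1 - a) * u" .
    have key: "2 * \<sigma> * norm B - \<sigma>\<^sup>2 * A \<le> \<kappa> * m" if \<sigma>: "0 < \<sigma>" for \<sigma>
    proof -
      let ?N = "\<lambda>\<zeta>. inv_norm_pow (DIM('a) + 2) (x - \<zeta>)"
      let ?l = "\<lambda>\<zeta>. 2 * \<sigma> * ((x - \<zeta>) \<bullet> e) - \<sigma>\<^sup>2 - (1 - a) * (norm (x - \<zeta>))\<^sup>2"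
      have intBe: "integrable lebesgue (\<lambda>\<zeta>. ((\<rho> \<zeta> * ?N \<zeta>) *\<^sub>R (x - \<zeta>)) \<bullet> e)"
        using intB by (rule integrable_inner_left)
      have Be: "B \<bullet> e = (\<integral>\<zeta>. ((\<rho> \<zeta> * ?N \<zeta>) *\<^sub>R (x - \<zeta>)) \<bullet> e \<partial>lebesgue)"
        unfolding B_def by (rule integral_inner_left[symmetric]) (rule intB)
      have expand: "\<rho> \<zeta> * ?N \<zeta> * ?l \<zeta> = 2 * \<sigma> * (((\<rho> \<zeta> * ?N \<zeta>) *\<^sub>R (x - \<zeta>)) \<bullet> e)
          - \<sigma>\<^sup>2 * (\<rho> \<zeta> * ?N \<zeta>) - (1 - a) * (\<rho> \<zeta> * inv_norm_pow DIM('a) (x - \<zeta>))" for \<zeta>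
      proof -
        have "(norm (x - \<zeta>))\<^sup>2 * ?N \<zeta> = inv_norm_pow DIM('a) (x - \<zeta>)"
          by (rule inv_norm_pow_add2) simp
        then show ?thesis
          by (simp only: inner_scaleR_left) (simp add: algebra_simps)
      qed
      have "2 * \<sigma> * norm B - \<sigma>\<^sup>2 * A - (1 - a) * u = (\<integral>\<zeta>. \<rho> \<zeta> * ?N \<zeta> * ?l \<zeta> \<partial>lebesgue)"
        unfolding expand e(2)[symmetric] Be A_def u_def
        using intBe intA intu by (simp del: inner_scaleR_left)
      \<comment> \<open>Bathtub principle: a density between 0 and 1 achieves at most what the
        indicator of the set where \<open>?l\<close> is positive achieves.\<close>
      also have "\<dots> \<le> (\<integral>\<zeta>. ?N \<zeta> * max 0 (?l \<zeta>) \<partial>lebesgue)"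
      proof (rule integral_mono)
        show "integrable lebesgue (\<lambda>\<zeta>. \<rho> \<zeta> * ?N \<zeta> * ?l \<zeta>)"
          unfolding expand using intBe intA intu by (simp del: inner_scaleR_left)
        show "\<rho> \<zeta> * ?N \<zeta> * ?l \<zeta> \<le> ?N \<zeta> * max 0 (?l \<zeta>)" for \<zeta>
        proof -
          have "\<rho> \<zeta> * ?l \<zeta> \<le> \<rho> \<zeta> * max 0 (?l \<zeta>)" using \<rho> by (intro mult_left_mono) auto
          also have "\<dots> \<le> max 0 (?l \<zeta>)" using \<rho>(2)[of \<zeta>] by (intro mult_left_le_one_le) (auto simp: \<rho>)
          finally have "?N \<zeta> * (\<rho> \<zeta> * ?l \<zeta>) \<le> ?N \<zeta> * max 0 (?l \<zeta>)"
            by (intro mult_left_mono inv_norm_pow_nonneg)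
          then show ?thesis by (simp only: mult_ac)
        qed
      qed (rule extremal_ball_integral(1)[OF e(1) a(1,2) \<sigma>])
      also have "\<dots> = ball_moment 1 (\<lambda>w. inv_norm_pow DIM('a) (e + w)) a"
        by (rule extremal_ball_integral(2)[OF e(1) a(1,2) \<sigma>])
      finally show ?thesis using H by simp
    qed
    have "0 < A"
    proof (rule ccontr)
      assume "\<not> 0 < A"
      then have "A = 0" using A0 by simp
      \<comment> \<open>With \<open>A = 0\<close> the bound is linear in \<open>\<sigma>\<close>;
        this \<open>\<sigma>\<close> makes its left side twice the right side.\<close>
      then have "2 * (\<kappa> * m) \<le> \<kappa> * m"
        using key[of "\<kappa> * m / norm B"] \<kappa> m False by simp
      then show False using mult_pos_pos[OF \<kappa> m(1)] by linarith
    qed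
    \<comment> \<open>The value \<open>\<sigma> = norm B / A\<close> maximises the quadratic on the
      left of \<open>key\<close>.\<close>
    then have "(norm B)\<^sup>2 / A \<le> \<kappa> * m"
      using key[of "norm B / A"] False by (simp add: power2_eq_square)
    then show ?thesis
      using \<open>0 < A\<close> by (simp add: m_def p_def pos_divide_le_eq)
  qed
qed

subsection \<open>The exponential transform\<close>

text \<open>The cone over the unit sphere is the closed unit ball without its centre.\<close>

lemma sphere_measure_unit_sphere:
  "sphere_measure (sphere (0::'a::euclidean_space) 1) = real DIM('a) * unit_ball_vol (real DIM('a))"
proof -
  have eq: "{r *\<^sub>R a |r a. 0 < r \<and> r \<le> 1 \<and> a \<in> sphere (0::'a) 1} = cball 0 1 - {0}"
  proof (intro equalityI subsetI)
    fix z :: 'a assume "z \<in> cball 0 1 - {0}"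
    then have "z = norm z *\<^sub>R (z /\<^sub>R norm z)" "0 < norm z" "norm z \<le> 1" "z /\<^sub>R norm z \<in> sphere 0 1"
      by auto
    then show "z \<in> {r *\<^sub>R a |r a. 0 < r \<and> r \<le> 1 \<and> a \<in> sphere (0::'a) 1}" by blast
  qed auto
  have "measure lebesgue (cball (0::'a) 1 - {0}) = measure lebesgue (cball (0::'a) 1)"
    by (intro measure_negligible_symdiff negligible_subset[OF negligible_sing[of 0]]) auto
  also have "\<dots> = unit_ball_vol (real DIM('a))"
    using content_cball[of 1 "0::'a"] by simp
  finally show ?thesis unfolding sphere_measure_def eq by (simp only:)
qed

text \<open>Treats both dimension cases at once, since the two functions of the potential have
  derivatives of this one shape. The Laplacian of the composite is
  \<open>\<phi>'' |\<nabla>u|^2 + \<phi>' \<Delta>u\<close>, and the ratio of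
  \<open>\<phi>''\<close> to \<open>\<phi>'\<close> is such that its nonnegativity follows from the
  gradient inequality.\<close>

lemma subharmonic_comp_potential:
  fixes \<rho> :: "'a::euclidean_space \<Rightarrow> real" and \<phi> :: "real \<Rightarrow> real"
  assumes n2: "2 \<le> DIM('a)" and dens: "density_function \<rho>"
    and nz: "emeasure lebesgue {x. \<rho> x \<noteq> 0} > 0"
  defines "n \<equiv> real DIM('a)" and "\<kappa> \<equiv> unit_ball_vol (real DIM('a))"
  defines "c \<equiv> 2 / (n * \<kappa>)"
  assumes \<beta>: "0 \<le> \<beta>"
    and \<phi>: "\<And>t. 0 < t \<Longrightarrow>
      (\<phi> has_real_derivative \<beta> * (c * exp (- (c * t))) * (1 - exp (- (c * t))) powr (- (2 / n))) (at t)"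
  shows "subharmonic_on (\<lambda>x. \<phi> (\<integral>\<zeta>. \<rho> \<zeta> * inv_norm_pow DIM('a) (x - \<zeta>) \<partial>lebesgue)) (- ess_support \<rho>)"
proof -
  let ?S = "ess_support \<rho>"
  have n: "2 \<le> n" using n2 by (simp add: n_def)
  have \<kappa>: "0 < \<kappa>" by (simp add: \<kappa>_def unit_ball_vol_pos)
  have c: "0 < c" "c * \<kappa> * n = 2" using n \<kappa> by (auto simp: c_def)
  have \<rho>[measurable]: "\<rho> \<in> borel_measurable lebesgue" and S: "compact ?S"
    and \<rho>01: "\<And>\<zeta>. 0 \<le> \<rho> \<zeta>" "\<And>\<zeta>. \<rho> \<zeta> \<le> 1"
    using dens by (auto simp: density_function_def)
  \<comment> \<open>Differentiating the potential needs a density that vanishes at every point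
    outside the compact support; \<open>\<rho>\<close> does so only almost everywhere.\<close>
  define \<mu> where "\<mu> \<zeta> = indicator ?S \<zeta> * \<rho> \<zeta>" for \<zeta>
  have \<mu>01: "0 \<le> \<mu> \<zeta>" "\<mu> \<zeta> \<le> 1" "\<bar>\<mu> \<zeta>\<bar> \<le> 1" "\<zeta> \<notin> ?S \<Longrightarrow> \<mu> \<zeta> = 0" for \<zeta>
    using \<rho>01[of \<zeta>] by (auto simp: \<mu>_def indicator_def)
  have [measurable]: "?S \<in> sets lebesgue" using S by (simp add: compact_imp_closed)
  have \<mu>[measurable]: "\<mu> \<in> borel_measurable lebesgue" unfolding \<mu>_def by measurable
  have [measurable]: "(\<lambda>\<zeta>::'a. \<zeta>) \<in> borel_measurable lebesgue"
    using measurable_completion[of "\<lambda>\<zeta>. \<zeta>" lborel borel] by simp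
  have ae: "AE \<zeta> in lebesgue. \<rho> \<zeta> = \<mu> \<zeta>"
    using AE_zero_outside_ess_support[of \<rho>] by eventually_elim (auto simp: \<mu>_def indicator_def)

  define u where "u x = (\<integral>\<zeta>. \<mu> \<zeta> * inv_norm_pow DIM('a) (x - \<zeta>) \<partial>lebesgue)" for x
  have u_eq: "(\<integral>\<zeta>. \<rho> \<zeta> * inv_norm_pow DIM('a) (x - \<zeta>) \<partial>lebesgue) = u x" for x
    unfolding u_def using ae by (intro integral_cong_AE) auto

  \<comment> \<open>\<open>g\<close> is the gradient of \<open>|z|^(-n)\<close>, and
    \<open>gg i\<close> is the gradient of its \<open>i\<close>-th component, a row of the
    Hessian.\<close>
  define g where "g z = (- n * inv_norm_pow (DIM('a) + 2) z) *\<^sub>R z" for z :: 'a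
  define gg where "gg i z = (- n * inv_norm_pow (DIM('a) + 2) z) *\<^sub>R i +
      (n * (n + 2) * inv_norm_pow (DIM('a) + 4) z * (z \<bullet> i)) *\<^sub>R z" for i z :: 'a
  have g_meas[measurable]: "g \<in> borel_measurable borel" unfolding g_def by measurable
  have gg_meas[measurable]: "gg i \<in> borel_measurable borel" for i unfolding gg_def by measurable
  have der_g: "(inv_norm_pow DIM('a) has_derivative (\<lambda>h. h \<bullet> g z)) (at z)" if "z \<noteq> 0" for z
    using has_derivative_inv_norm_pow[OF that, of "DIM('a)"] unfolding g_def n_def .
  have der_gg: "((\<lambda>z. g z \<bullet> i) has_derivative (\<lambda>h. h \<bullet> gg i z)) (at z)" if z: "z \<noteq> 0" for z i
  proof -
    have "((\<lambda>z. (- n * inv_norm_pow (DIM('a) + 2) z) * (z \<bullet> i)) has_derivative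
        (\<lambda>h. (- n * inv_norm_pow (DIM('a) + 2) z) * (h \<bullet> i) +
          (- n * (h \<bullet> ((- real (DIM('a) + 2) * inv_norm_pow (DIM('a) + 2 + 2) z) *\<^sub>R z))) * (z \<bullet> i))) (at z)"
      by (intro has_derivative_mult has_derivative_mult_right has_derivative_inv_norm_pow z
          has_derivative_inner_left has_derivative_ident)
    moreover have "DIM('a) + 2 + 2 = DIM('a) + 4" by simp
    ultimately show ?thesis
      unfolding g_def gg_def inner_scaleR_left
      by (elim has_derivative_eq_rhs) (simp only:, simp add: fun_eq_iff inner_simps n_def algebra_simps)
  qed
  have cont_g: "continuous_on (- {0}) g" "continuous_on (- {0}) (gg i)" for i
    unfolding g_def gg_def by (intro continuous_intros continuous_on_inv_norm_pow; simp)+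
  note conv = has_derivative_convolution[OF \<mu> \<mu>01(3) S \<mu>01(4)]

  \<comment> \<open>Outside the support, \<open>G\<close> is the gradient of \<open>u\<close> and
    \<open>L i\<close> its pure second derivative in direction \<open>i\<close>.\<close>
  define G where "G x = (\<integral>\<zeta>. \<mu> \<zeta> *\<^sub>R g (x - \<zeta>) \<partial>lebesgue)" for x
  define L where "L i x = i \<bullet> (\<integral>\<zeta>. \<mu> \<zeta> *\<^sub>R gg i (x - \<zeta>) \<partial>lebesgue)" for i x
  have intu: "integrable lebesgue (\<lambda>\<zeta>. \<mu> \<zeta> * inv_norm_pow DIM('a) (x - \<zeta>))"
    and intG: "integrable lebesgue (\<lambda>\<zeta>. \<mu> \<zeta> *\<^sub>R g (x - \<zeta>))"
    and der_u: "(u has_derivative (\<lambda>h. h \<bullet> G x)) (at x)" if "x \<notin> ?S" for x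
    using conv[OF _ that _ g_meas der_g cont_g(1)] by (simp_all add: u_def[abs_def] G_def)
  have Gi: "G x \<bullet> i = (\<integral>\<zeta>. \<mu> \<zeta> * (g (x - \<zeta>) \<bullet> i) \<partial>lebesgue)" if "x \<notin> ?S" for x i
    unfolding G_def using integral_inner_left[of i lebesgue "\<lambda>\<zeta>. \<mu> \<zeta> *\<^sub>R g (x - \<zeta>)"] intG[OF that] by simp
  have intL: "integrable lebesgue (\<lambda>\<zeta>. \<mu> \<zeta> *\<^sub>R gg i (x - \<zeta>))"
    and der_G: "((\<lambda>x. G x \<bullet> i) has_derivative (\<lambda>h. h \<bullet> (\<integral>\<zeta>. \<mu> \<zeta> *\<^sub>R gg i (x - \<zeta>) \<partial>lebesgue))) (at x)"
    if x: "x \<notin> ?S" for x i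
  proof -
    note r = conv[OF _ x _ gg_meas der_gg cont_g(2), of i]
    show "integrable lebesgue (\<lambda>\<zeta>. \<mu> \<zeta> *\<^sub>R gg i (x - \<zeta>))" using r(2) by simp
    have "((\<lambda>x. \<integral>\<zeta>. \<mu> \<zeta> * (g (x - \<zeta>) \<bullet> i) \<partial>lebesgue) has_derivative
        (\<lambda>h. h \<bullet> (\<integral>\<zeta>. \<mu> \<zeta> *\<^sub>R gg i (x - \<zeta>) \<partial>lebesgue))) (at x)"
      using r(3) by simp
    then show "((\<lambda>x. G x \<bullet> i) has_derivative (\<lambda>h. h \<bullet> (\<integral>\<zeta>. \<mu> \<zeta> *\<^sub>R gg i (x - \<zeta>) \<partial>lebesgue))) (at x)"
      by (rule has_derivative_transform_within_open[OF _ open_Compl_ess_support[of \<rho>]])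
        (use x in \<open>auto simp: Gi\<close>)
  qed

  have u_pos: "0 < u x" if x: "x \<notin> ?S" for x
  proof -
    have nonneg: "0 \<le> \<mu> \<zeta> * inv_norm_pow DIM('a) (x - \<zeta>)" for \<zeta>
      by (simp add: \<mu>01 inv_norm_pow_nonneg)
    have "u x \<noteq> 0"
    proof
      assume "u x = 0"
      then have "AE \<zeta> in lebesgue. \<mu> \<zeta> * inv_norm_pow DIM('a) (x - \<zeta>) = 0"
        unfolding u_def using integral_nonneg_eq_0_iff_AE[OF intu[OF x]] nonneg by simp
      with ae have "AE \<zeta> in lebesgue. \<rho> \<zeta> = 0"
      proof eventually_elim
        case (elim \<zeta>)
        \<comment> \<open>At \<open>\<zeta> = x\<close> the kernel is 0 by the division convention,
          so there the vanishing of \<open>\<mu>\<close> comes from \<open>x\<close> lying outside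
          the support.\<close>
        have "\<mu> \<zeta> = 0"
        proof (cases "\<zeta> = x")
          case True then show ?thesis using \<mu>01(4) x by simp
        next
          case False then show ?thesis using elim by (simp add: inv_norm_pow_def)
        qed
        then show ?case using elim by simp
      qed
      moreover have "{x \<in> space lebesgue. \<rho> x \<noteq> 0} \<in> sets lebesgue" by measurable
      ultimately have "emeasure lebesgue {x. \<rho> x \<noteq> 0} = 0"
        by (subst (asm) AE_iff_measurable[of "{x. \<rho> x \<noteq> 0}"]) auto
      then show False using nz by simp
    qed
    moreover have "0 \<le> u x" unfolding u_def using nonneg by simp
    ultimately show ?thesis by simp
  qed

  define A where "A x = (\<integral>\<zeta>. \<mu> \<zeta> * inv_norm_pow (DIM('a) + 2) (x - \<zeta>) \<partial>lebesgue)" for x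
  \<comment> \<open>The pointwise trace of the Hessian kernel is \<open>2 n |z|^(-n-2)\<close>;
    besides the value of the Laplacian this gives the integrability of the integrand of
    \<open>A\<close>.\<close>
  have trace: "(\<Sum>i\<in>Basis. L i x) = 2 * n * A x"
    and intA: "integrable lebesgue (\<lambda>\<zeta>. \<mu> \<zeta> * inv_norm_pow (DIM('a) + 2) (x - \<zeta>))" if x: "x \<notin> ?S" for x
  proof -
    have pt: "(\<Sum>i\<in>Basis. i \<bullet> (\<mu> \<zeta> *\<^sub>R gg i (x - \<zeta>))) = 2 * n * (\<mu> \<zeta> * inv_norm_pow (DIM('a) + 2) (x - \<zeta>))" for \<zeta>
    proof -
      let ?z = "x - \<zeta>"
      have "(\<Sum>i\<in>Basis. i \<bullet> gg i ?z) = (\<Sum>i\<in>(Basis :: 'a set). - n * inv_norm_pow (DIM('a) + 2) ?z) +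
          (\<Sum>i\<in>Basis. n * (n + 2) * inv_norm_pow (DIM('a) + 4) ?z * (?z \<bullet> i)\<^sup>2)"
        unfolding sum.distrib[symmetric]
        by (intro sum.cong refl) (simp add: gg_def inner_simps inner_commute power2_eq_square)
      also have "\<dots> = n * (- n * inv_norm_pow (DIM('a) + 2) ?z) +
          n * (n + 2) * ((norm ?z)\<^sup>2 * inv_norm_pow (DIM('a) + 4) ?z)"
        by (simp only: sum_distrib_left[symmetric] sum_Basis_inner_square) (simp add: n_def)
      also have "(norm ?z)\<^sup>2 * inv_norm_pow (DIM('a) + 4) ?z = inv_norm_pow (DIM('a) + 2) ?z"
      proof -
        have "DIM('a) + 2 + 2 = DIM('a) + 4" by simp
        then show ?thesis using inv_norm_pow_add2[of ?z "DIM('a) + 2"] by (simp only:) simp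
      qed
      finally have "(\<Sum>i\<in>Basis. i \<bullet> gg i ?z) = 2 * n * inv_norm_pow (DIM('a) + 2) ?z"
        by (simp add: algebra_simps)
      then show ?thesis
        by (simp only: inner_scaleR_right sum_distrib_left[symmetric]) simp
    qed
    have int: "integrable lebesgue (\<lambda>\<zeta>. i \<bullet> (\<mu> \<zeta> *\<^sub>R gg i (x - \<zeta>)))" for i
      by (rule integrable_inner_right[OF intL[OF x]])
    have "integrable lebesgue (\<lambda>\<zeta>. \<Sum>i\<in>Basis. i \<bullet> (\<mu> \<zeta> *\<^sub>R gg i (x - \<zeta>)))"
      by (intro Bochner_Integration.integrable_sum int)
    then show "integrable lebesgue (\<lambda>\<zeta>. \<mu> \<zeta> * inv_norm_pow (DIM('a) + 2) (x - \<zeta>))"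
      unfolding pt using n by simp
    have "(\<Sum>i\<in>Basis. L i x) = (\<Sum>i\<in>Basis. (\<integral>\<zeta>. i \<bullet> (\<mu> \<zeta> *\<^sub>R gg i (x - \<zeta>)) \<partial>lebesgue))"
      unfolding L_def by (intro sum.cong refl integral_inner_right[symmetric] intL x)
    also have "\<dots> = (\<integral>\<zeta>. (\<Sum>i\<in>Basis. i \<bullet> (\<mu> \<zeta> *\<^sub>R gg i (x - \<zeta>))) \<partial>lebesgue)"
      by (intro Bochner_Integration.integral_sum[symmetric] int)
    also have "\<dots> = 2 * n * A x" unfolding pt A_def by simp
    finally show "(\<Sum>i\<in>Basis. L i x) = 2 * n * A x" .
  qed

  define E where "E x = exp (- (c * u x))" for x
  have grad: "(norm (G x))\<^sup>2 \<le> n\<^sup>2 * (\<kappa> * ((1 - E x) / (1 - (1 - 2 / n) * E x)) * A x)" if x: "x \<notin> ?S" for x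
  proof -
    have eqB: "\<mu> \<zeta> *\<^sub>R g (x - \<zeta>) =
        (- n) *\<^sub>R ((\<mu> \<zeta> * inv_norm_pow (DIM('a) + 2) (x - \<zeta>)) *\<^sub>R (x - \<zeta>))" for \<zeta>
      by (simp add: g_def)
    have intB: "integrable lebesgue (\<lambda>\<zeta>. (\<mu> \<zeta> * inv_norm_pow (DIM('a) + 2) (x - \<zeta>)) *\<^sub>R (x - \<zeta>))"
      using integrable_scaleR_right[of "- (1 / n)" lebesgue, OF intG[OF x]] n by (simp add: g_def)
    let ?B = "\<integral>\<zeta>. (\<mu> \<zeta> * inv_norm_pow (DIM('a) + 2) (x - \<zeta>)) *\<^sub>R (x - \<zeta>) \<partial>lebesgue"
    have "G x = (- n) *\<^sub>R ?B" unfolding G_def eqB by (rule integral_scaleR_right)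
    then have "(norm (G x))\<^sup>2 = n\<^sup>2 * (norm ?B)\<^sup>2" by (simp add: power_mult_distrib)
    also have "exp (- (2 / n) * (u x / \<kappa>)) = E x" by (simp add: E_def c_def)
    then have "(norm ?B)\<^sup>2 \<le> \<kappa> * ((1 - E x) / (1 - (1 - 2 / n) * E x)) * A x"
      using gradient_inequality[OF n2 \<mu>01(1,2) intu[OF x] intA[OF x] intB] u_pos[OF x]
      unfolding \<kappa>_def[symmetric] unfolding n_def[symmetric] u_def[symmetric] A_def[symmetric] by simp
    then have "n\<^sup>2 * (norm ?B)\<^sup>2 \<le> n\<^sup>2 * (\<kappa> * ((1 - E x) / (1 - (1 - 2 / n) * E x)) * A x)"
      by (intro mult_left_mono) auto
    finally show ?thesis .
  qed

  define \<phi>' where "\<phi>' t = \<beta> * (c * exp (- (c * t))) * (1 - exp (- (c * t))) powr (- (2 / n))" for t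
  \<comment> \<open>Obtained as \<open>\<phi>'\<close> times its logarithmic derivative.\<close>
  define \<phi>'' where "\<phi>'' t = - (\<phi>' t * c * (1 + 2 / n * (exp (- (c * t)) / (1 - exp (- (c * t))))))" for t
  have \<phi>1: "(\<phi> has_real_derivative \<phi>' t) (at t)" if "0 < t" for t
    using \<phi>[OF that] by (simp add: \<phi>'_def)
  have \<phi>2: "(\<phi>' has_real_derivative \<phi>'' t) (at t)" if "0 < t" for t
  proof -
    let ?e = "exp (- (c * t))"
    have e: "0 < 1 - ?e" using c(1) that by simp
    have "?e < 1" using e by simp
    have de: "((\<lambda>t. exp (- (c * t))) has_real_derivative - (c * ?e)) (at t)"
      by (auto intro!: derivative_eq_intros)
    have d1: "((\<lambda>t. 1 - exp (- (c * t))) has_real_derivative c * ?e) (at t)"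
      using DERIV_diff[OF DERIV_const[of 1] de] by simp
    have d2: "((\<lambda>t. (1 - exp (- (c * t))) powr (- (2 / n))) has_real_derivative
        - (2 / n) * (1 - ?e) powr (- (2 / n) - 1) * (c * ?e)) (at t)"
      by (rule DERIV_chain2[of "\<lambda>s. s powr (- (2 / n))"]) (use e d1 in \<open>auto intro!: derivative_eq_intros\<close>)
    have pw: "(1 - ?e) powr (- (2 / n) - 1) = (1 - ?e) powr (- (2 / n)) / (1 - ?e)"
      using e by (simp add: powr_diff)
    show ?thesis
      unfolding \<phi>'_def
      by (rule DERIV_cong[OF DERIV_mult[OF DERIV_cmult[OF DERIV_cmult[OF de, of c], of \<beta>] d2]])
        (simp add: \<phi>''_def \<phi>'_def pw algebra_simps)
  qed

  have "subharmonic_on (\<lambda>x. \<phi> (u x)) (- ?S)"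
  proof (rule laplacian_nonneg_imp_subharmonic_on[where g="\<lambda>i x. \<phi>' (u x) * (G x \<bullet> i)"
        and k="\<lambda>i x. \<phi>'' (u x) * (G x \<bullet> i)\<^sup>2 + \<phi>' (u x) * L i x"])
    show "open (- ?S)" by (rule open_Compl_ess_support)
    show "continuous_on (- ?S) (\<lambda>x. \<phi> (u x))"
    proof (intro continuous_at_imp_continuous_on ballI)
      fix x assume "x \<in> - ?S"
      then show "isCont (\<lambda>x. \<phi> (u x)) x"
        using has_derivative_continuous[OF der_u] DERIV_isCont[OF \<phi>1[OF u_pos]]
        by (intro isCont_o2[where f=u and g=\<phi>]) auto
    qed
    fix x i :: 'a assume "x \<in> - ?S" and i: "i \<in> Basis"
    then have x: "x \<notin> ?S" by simp
    have du: "((\<lambda>t. u (x + t *\<^sub>R i)) has_real_derivative G x \<bullet> i) (at 0)"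
      using has_derivative_line[of u "\<lambda>h. h \<bullet> G x" x 0 i] der_u[OF x] by (simp add: inner_commute)
    have dG: "((\<lambda>t. G (x + t *\<^sub>R i) \<bullet> i) has_real_derivative L i x) (at 0)"
      unfolding L_def
      using has_derivative_line[of "\<lambda>x. G x \<bullet> i" "\<lambda>h. h \<bullet> (\<integral>\<zeta>. \<mu> \<zeta> *\<^sub>R gg i (x - \<zeta>) \<partial>lebesgue)" x 0 i]
        der_G[OF x] by simp
    show "((\<lambda>t. \<phi> (u (x + t *\<^sub>R i))) has_real_derivative \<phi>' (u x) * (G x \<bullet> i)) (at 0)"
      using DERIV_chain2[OF _ du, of \<phi>] \<phi>1[OF u_pos[OF x]] by simp
    have "((\<lambda>t. \<phi>' (u (x + t *\<^sub>R i))) has_real_derivative \<phi>'' (u x) * (G x \<bullet> i)) (at 0)"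
      using DERIV_chain2[OF _ du, of \<phi>'] \<phi>2[OF u_pos[OF x]] by simp
    from DERIV_mult[OF this dG]
    show "((\<lambda>t. \<phi>' (u (x + t *\<^sub>R i)) * (G (x + t *\<^sub>R i) \<bullet> i)) has_real_derivative
        \<phi>'' (u x) * (G x \<bullet> i)\<^sup>2 + \<phi>' (u x) * L i x) (at 0)"
      by (rule DERIV_cong) (simp add: power2_eq_square algebra_simps)
  next
    fix x assume "x \<in> - ?S"
    then have x: "x \<notin> ?S" by simp
    define D where "D = 1 - (1 - 2 / n) * E x"
    have E: "0 < E x" "E x < 1" using u_pos[OF x] c(1) by (auto simp: E_def)
    have "(1 - 2 / n) * E x \<le> 1 * E x" using n E by (intro mult_right_mono) auto
    then have D: "0 < D" using E unfolding D_def by linarith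
    have \<phi>'0: "0 \<le> \<phi>' (u x)" using \<beta> c(1) by (simp add: \<phi>'_def)
    have frac: "1 + 2 / n * (E x / (1 - E x)) = D / (1 - E x)"
    proof -
      have "1 + q * (y / (1 - y)) = (1 - (1 - q) * y) / (1 - y)" if "y < 1" for q y :: real
        using that by (simp add: field_simps)
      from this[OF E(2)] show ?thesis by (simp only: D_def)
    qed
    \<comment> \<open>The factor \<open>D / (1 - E x)\<close> cancels the fraction in the gradient
      bound, and \<open>c * \<kappa> * n = 2\<close> leaves exactly the Laplacian
      \<open>2 * n * A x\<close>.\<close>
    have "c * (D / (1 - E x)) * (norm (G x))\<^sup>2 \<le> c * (D / (1 - E x)) * (n\<^sup>2 * (\<kappa> * ((1 - E x) / D) * A x))"
      using grad[OF x] c(1) D E unfolding D_def[symmetric] by (intro mult_left_mono) auto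
    also have "\<dots> = (c * \<kappa> * n) * n * A x" using D E by (simp add: power2_eq_square)
    also have "\<dots> = 2 * n * A x" by (simp only: c(2))
    finally have "\<phi>' (u x) * (c * (D / (1 - E x)) * (norm (G x))\<^sup>2) \<le> \<phi>' (u x) * (2 * n * A x)"
      using \<phi>'0 by (rule mult_left_mono)
    moreover have "\<phi>'' (u x) = - (\<phi>' (u x) * c * (D / (1 - E x)))"
      unfolding \<phi>''_def E_def[symmetric] frac ..
    moreover have "(\<Sum>i\<in>Basis. \<phi>'' (u x) * (G x \<bullet> i)\<^sup>2 + \<phi>' (u x) * L i x) =
        \<phi>'' (u x) * (norm (G x))\<^sup>2 + \<phi>' (u x) * (2 * n * A x)"
      by (simp only: sum.distrib sum_distrib_left[symmetric] sum_Basis_inner_square trace[OF x])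
    ultimately show "0 \<le> (\<Sum>i\<in>Basis. \<phi>'' (u x) * (G x \<bullet> i)\<^sup>2 + \<phi>' (u x) * L i x)"
      by (simp add: mult.assoc)
  qed
  then show ?thesis by (simp only: u_eq)
qed

theorem theorem1p1:
  fixes \<rho> :: "real ^ 'n \<Rightarrow> real"
  assumes "CARD('n) \<ge> 2"
    and "density_function \<rho>"
    and "emeasure lebesgue {x. \<rho> x \<noteq> 0} > 0"
  shows "subharmonic_on
           (\<lambda>x. if CARD('n) = 2 then ln (1 - exp_transform \<rho> x)
                else 1 / (real CARD('n) - 2) *
                  (1 - exp_transform \<rho> x) powr ((real CARD('n) - 2) / real CARD('n)))
           (- ess_support \<rho>)"
proof -
  let ?n = "real CARD('n)"
  define c where "c = 2 / (?n * unit_ball_vol ?n)"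
  have n: "2 \<le> ?n" using assms(1) by simp
  have c: "0 < c" using n by (simp add: c_def unit_ball_vol_pos)
  let ?u = "\<lambda>x. \<integral>\<zeta>. \<rho> \<zeta> * inv_norm_pow CARD('n) (x - \<zeta>) \<partial>lebesgue"
  have E: "exp_transform \<rho> x = exp (- (c * ?u x))" for x
    by (simp add: exp_transform_def sphere_measure_unit_sphere inv_norm_pow_def c_def)
  have n2: "2 \<le> DIM(real ^ 'n)" using assms(1) by simp
  note main = subharmonic_comp_potential[OF n2 assms(2,3), unfolded DIM_cart DIM_real mult_1_right, folded c_def]
  have e: "0 < 1 - exp (- (c * t))" if "0 < t" for t
    using c that by simp
  have de: "((\<lambda>t. 1 - exp (- (c * t))) has_real_derivative c * exp (- (c * t))) (at t)" for t
    by (auto intro!: derivative_eq_intros)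
  show ?thesis
  proof (cases "CARD('n) = 2")
    case True
    have "subharmonic_on (\<lambda>x. ln (1 - exp (- (c * ?u x)))) (- ess_support \<rho>)"
    \<comment> \<open>For dimension 2 the exponent \<open>- (2 / n)\<close> is -1, and the
      prescribed derivative with \<open>\<beta> = 1\<close> is that of the logarithm.\<close>
    proof (rule main[of 1 "\<lambda>t. ln (1 - exp (- (c * t)))"])
      fix t :: real assume t: "0 < t"
      have "((\<lambda>t. ln (1 - exp (- (c * t)))) has_real_derivative 1 / (1 - exp (- (c * t))) * (c * exp (- (c * t)))) (at t)"
        by (rule DERIV_chain2[of ln, OF DERIV_ln_divide[OF e[OF t]] de])
      then show "((\<lambda>t. ln (1 - exp (- (c * t)))) has_real_derivative
          1 * (c * exp (- (c * t))) * (1 - exp (- (c * t))) powr (- (2 / ?n))) (at t)"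
        by (rule DERIV_cong) (use e[OF t] True in \<open>simp add: powr_minus divide_simps\<close>)
    qed simp
    then show ?thesis using True by (simp add: E)
  next
    case False
    then have n3: "2 < ?n" using n by simp
    have "subharmonic_on (\<lambda>x. 1 / (?n - 2) * (1 - exp (- (c * ?u x))) powr ((?n - 2) / ?n)) (- ess_support \<rho>)"
    \<comment> \<open>Here \<open>\<beta> = 1 / n\<close>, since the exponent
      \<open>(n - 2) / n\<close> brought down by differentiation meets the prefactor
      \<open>1 / (n - 2)\<close>.\<close>
    proof (rule main[of "1 / ?n" "\<lambda>t. 1 / (?n - 2) * (1 - exp (- (c * t))) powr ((?n - 2) / ?n)"])
      fix t :: real assume t: "0 < t"
      have "((\<lambda>t. (1 - exp (- (c * t))) powr ((?n - 2) / ?n)) has_real_derivative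
          (?n - 2) / ?n * (1 - exp (- (c * t))) powr ((?n - 2) / ?n - 1) * (c * exp (- (c * t)))) (at t)"
        by (rule DERIV_chain2[of "\<lambda>s. s powr ((?n - 2) / ?n)", OF _ de])
          (use e[OF t] in \<open>auto intro!: derivative_eq_intros\<close>)
      from DERIV_cmult[OF this, of "1 / (?n - 2)"]
      have "((\<lambda>t. 1 / (?n - 2) * (1 - exp (- (c * t))) powr ((?n - 2) / ?n)) has_real_derivative
          1 / (?n - 2) * ((?n - 2) / ?n * (1 - exp (- (c * t))) powr ((?n - 2) / ?n - 1) * (c * exp (- (c * t))))) (at t)" .
      moreover have "(?n - 2) / ?n - 1 = - (2 / ?n)" using n3 by (simp add: field_simps)
      ultimately show "((\<lambda>t. 1 / (?n - 2) * (1 - exp (- (c * t))) powr ((?n - 2) / ?n)) has_real_derivative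
          1 / ?n * (c * exp (- (c * t))) * (1 - exp (- (c * t))) powr (- (2 / ?n))) (at t)"
        using n3 by (elim DERIV_cong) (simp only:, simp)
    qed simp
    then show ?thesis using False by (simp add: E)
  qed
qed

end
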